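(* Let $M$ be a closed non-orientable surface of genus $k$ with $k \geq 3$. Then the map $$o_2 : \pi_0 (\mathrm{Hom} (\pi_1 (M) , \mathrm{PSL}(2,\mathbb{R}))) \longrightarrow \mathbb{Z} / 2 \mathbb{Z}$$ given by the obstruction class is a bijection. In particular, the set $\mathrm{Hom} (\pi_1 (M) , \mathrm{PSL}(2,\mathbb{R}))$ consists of two connected components, which are the preimages $o_2^{-1} (n)$, where $n \in \mathbb{Z} / 2 \mathbb{Z}$.
   Context: Surfaces are connected. A closed non-orientable surface $M$ of genus $k$ is the connected sum of $k$ projective planes; its fundamental group has the presentation $\pi_1(M) = \langle A_1 , \dots , A_k \mid A_1^2 \cdots A_k^2 \rangle$. Let $G = \mathrm{PSL}(2,\mathbb{R})$; the space $\mathrm{Hom}(\pi_1(M), G)$ of homomorphisms is topologized as a subspace of $G^k$ via the images of the generators, and $\pi_0$ denotes its set of connected components. Let $p:\widetilde{G} \to G$ be the universal cover of $G$; its kernel is the center $Z(\widetilde G) = \langle z\rangle \cong \pi_1(G)\cong \mathbb{Z}$. Obstruction class: for $\phi \in \mathrm{Hom}(\pi_1(M), G)$ choose arbitrary lifts $\widetilde{\phi(A_1)}, \dots, \widetilde{\phi(A_k)} \in \widetilde{G}$ of $\phi(A_1),\dots,\phi(A_k)$. The element $(\widetilde{\phi (A_1)})^2 \cdots (\widetilde{\phi (A_k)})^2$ is a lift of the identity, hence equals $z^N$ for some $N \in \mathbb{Z}$, and the class of $N$ modulo $2$ is independent of the chosen lifts; it is denoted $o_2(\phi) \in \mathbb{Z}/2\mathbb{Z}$.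 The map $o_2$ is continuous, hence constant on connected components, and so induces a map, also denoted $o_2$, on $\pi_0(\mathrm{Hom}(\pi_1(M),G))$. *)

theory Defs
  imports
    "HOL-Analysis.Analysis"
    "HOL-Algebra.Generated_Groups"
    "HOL-Library.Z2"
begin

section \<open>Quotient topologies\<close>

definition quotient_topology :: "'a topology \<Rightarrow> ('a \<Rightarrow> 'b) \<Rightarrow> 'b topology" where
  "quotient_topology X f =
     topology (\<lambda>U. U \<subseteq> f ` topspace X \<and> openin X {x \<in> topspace X. f x \<in> U})"

lemma openin_quotient_topology:
  "openin (quotient_topology X f) U \<longleftrightarrow>
     U \<subseteq> f ` topspace X \<and> openin X {x \<in> topspace X. f x \<in> U}"
proof -
  have "istopology (\<lambda>U. U \<subseteq> f ` topspace X \<and> openin X {x \<in> topspace X. f x \<in> U})"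
    unfolding istopology_def
  proof (intro conjI allI impI)
    fix S T
    assume S: "S \<subseteq> f ` topspace X \<and> openin X {x \<in> topspace X. f x \<in> S}"
      and T: "T \<subseteq> f ` topspace X \<and> openin X {x \<in> topspace X. f x \<in> T}"
    show "S \<inter> T \<subseteq> f ` topspace X" using S by blast
    have "{x \<in> topspace X. f x \<in> S \<inter> T} = {x \<in> topspace X. f x \<in> S} \<inter> {x \<in> topspace X. f x \<in> T}"
      by blast
    then show "openin X {x \<in> topspace X. f x \<in> S \<inter> T}" using S T by auto
  next
    fix K
    assume K: "\<forall>U\<in>K. U \<subseteq> f ` topspace X \<and> openin X {x \<in> topspace X. f x \<in> U}"
    show "\<Union>K \<subseteq> f ` topspace X" using K by blast
    have "{x \<in> topspace X. f x \<in> \<Union>K} = (\<Union>U\<in>K. {x \<in> topspace X. f x \<in> U})"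
      by blast
    then show "openin X {x \<in> topspace X. f x \<in> \<Union>K}" using K by auto
  qed
  then show ?thesis
    by (simp add: quotient_topology_def topology_inverse')
qed

lemma quotient_map_quotient_topology: "quotient_map X (quotient_topology X f) f"
proof -
  have "{x \<in> topspace X. f x \<in> f ` topspace X} = topspace X"
    by blast
  then have "openin X {x \<in> topspace X. f x \<in> f ` topspace X}"
    by simp
  then have "topspace (quotient_topology X f) = f ` topspace X"
    by (metis openin_quotient_topology openin_subset openin_topspace subset_antisym subset_refl)
  then show ?thesis
    by (auto simp: quotient_map_def openin_quotient_topology)
qed

section \<open>Homotopy classes of paths and the fundamental group\<close>

text \<open>Paths are functions on \<open>real\<close> of which only the restriction to \<open>{0..1}\<close> matters;
  homotopies keep both endpoints fixed.\<close>

definition path_homotopic :: "'a topology \<Rightarrow> (real \<Rightarrow> 'a) \<Rightarrow> (real \<Rightarrow> 'a) \<Rightarrow> bool" where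
  "path_homotopic X p q \<longleftrightarrow>
     homotopic_with (\<lambda>r. r 0 = p 0 \<and> r 1 = p 1) (top_of_set {0..1}) X p q"

definition path_class :: "'a topology \<Rightarrow> (real \<Rightarrow> 'a) \<Rightarrow> (real \<Rightarrow> 'a) set" where
  "path_class X p = {q. path_homotopic X p q}"

definition path_concat :: "(real \<Rightarrow> 'a) \<Rightarrow> (real \<Rightarrow> 'a) \<Rightarrow> real \<Rightarrow> 'a" where
  "path_concat p q = (\<lambda>t. if t \<le> 1/2 then p (2 * t) else q (2 * t - 1))"

definition fundamental_group :: "'a topology \<Rightarrow> 'a \<Rightarrow> (real \<Rightarrow> 'a) set monoid" where
  "fundamental_group X x =
     \<lparr>carrier = path_class X ` {p. pathin X p \<and> p 0 = x \<and> p 1 = x},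
      monoid.mult = (\<lambda>C D. \<Union>p\<in>C. \<Union>q\<in>D. path_class X (path_concat p q)),
      one = path_class X (\<lambda>_. x)\<rparr>"

section \<open>Closed non-orientable surfaces\<close>

definition projective_plane :: "(real^3) set topology" where
  "projective_plane = quotient_topology (top_of_set (sphere 0 1)) (\<lambda>x. {x, -x})"

text \<open>\<open>Z\<close> is obtained by removing the interiors of closed discs embedded in \<open>X\<close> and in \<open>Y\<close>
  and gluing along the boundary circles: the images \<open>P\<close>, \<open>Q\<close> of the two pieces in \<open>Z\<close> are
  closed, cover \<open>Z\<close>, and meet exactly in the common image of the two circles.\<close>

definition is_connected_sum :: "'a topology \<Rightarrow> 'b topology \<Rightarrow> 'c topology \<Rightarrow> bool" where
  "is_connected_sum X Y Z \<longleftrightarrow>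
     (\<exists>(d :: complex \<Rightarrow> 'a) (e :: complex \<Rightarrow> 'b) P Q f g.
        embedding_map (top_of_set (cball 0 1)) X d \<and>
        embedding_map (top_of_set (cball 0 1)) Y e \<and>
        closedin Z P \<and> closedin Z Q \<and> P \<union> Q = topspace Z \<and>
        homeomorphic_map (subtopology X (topspace X - d ` ball 0 1)) (subtopology Z P) f \<and>
        homeomorphic_map (subtopology Y (topspace Y - e ` ball 0 1)) (subtopology Z Q) g \<and>
        f ` d ` sphere 0 1 = P \<inter> Q \<and> g ` e ` sphere 0 1 = P \<inter> Q)"

text \<open>The intermediate summands are required to live on the same type \<open>'a\<close>; this is no
  restriction, since all the spaces involved have the cardinality of the continuum.\<close>

inductive closed_nonorientable_surface :: "nat \<Rightarrow> 'a topology \<Rightarrow> bool" where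
  "M homeomorphic_space projective_plane \<Longrightarrow> closed_nonorientable_surface 1 M"
| "closed_nonorientable_surface k N \<Longrightarrow> is_connected_sum N projective_plane M
     \<Longrightarrow> closed_nonorientable_surface (Suc k) M"

section \<open>Group presentations\<close>

text \<open>The letter \<open>(a, True)\<close> stands for the generator \<open>a\<close> and \<open>(a, False)\<close> for its inverse.\<close>

definition words_over :: "'a set \<Rightarrow> ('a \<times> bool) list set" where
  "words_over S = lists (S \<times> UNIV)"

definition word_reductions ::
  "'a set \<Rightarrow> ('a \<times> bool) list set \<Rightarrow> (('a \<times> bool) list \<times> ('a \<times> bool) list) set" where
  "word_reductions S R =
     {(u @ r @ v, u @ v) | u r v. u \<in> words_over S \<and> v \<in> words_over S \<and>
        r \<in> R \<union> {[(a, b), (a, \<not> b)] | a b. a \<in> S}}"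

definition word_equiv ::
  "'a set \<Rightarrow> ('a \<times> bool) list set \<Rightarrow> (('a \<times> bool) list \<times> ('a \<times> bool) list) set" where
  "word_equiv S R =
     (word_reductions S R \<union> (word_reductions S R)\<inverse>)\<^sup>* \<inter> (words_over S \<times> words_over S)"

definition presented_group ::
  "'a set \<Rightarrow> ('a \<times> bool) list set \<Rightarrow> ('a \<times> bool) list set monoid" where
  "presented_group S R =
     \<lparr>carrier = words_over S // word_equiv S R,
      monoid.mult = (\<lambda>C D. \<Union>u\<in>C. \<Union>v\<in>D. word_equiv S R `` {u @ v}),
      one = word_equiv S R `` {[]}\<rparr>"

definition presented_gen :: "'a set \<Rightarrow> ('a \<times> bool) list set \<Rightarrow> 'a \<Rightarrow> ('a \<times> bool) list set" where
  "presented_gen S R a = word_equiv S R `` {[(a, True)]}"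

text \<open>\<open>\<Gamma> = \<langle>S | R\<rangle>\<close>, where \<open>A a \<in> \<Gamma>\<close> is the element named by the generator \<open>a \<in> S\<close>.\<close>

definition has_presentation ::
  "('g, 'm) monoid_scheme \<Rightarrow> 'a set \<Rightarrow> ('a \<times> bool) list set \<Rightarrow> ('a \<Rightarrow> 'g) \<Rightarrow> bool" where
  "has_presentation \<Gamma> S R A \<longleftrightarrow>
     (\<exists>f \<in> iso (presented_group S R) \<Gamma>. \<forall>a\<in>S. f (presented_gen S R a) = A a)"

text \<open>The word \<open>A\<^sub>1\<^sup>2 \<cdots> A\<^sub>k\<^sup>2\<close>; the generators are indexed by \<open>0, \<dots>, k - 1\<close>.\<close>

definition squares_word :: "nat \<Rightarrow> (nat \<times> bool) list" where
  "squares_word k = concat (map (\<lambda>i. [(i, True), (i, True)]) [0..<k])"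

section \<open>\<open>PSL(2,\<real>)\<close> and its universal cover\<close>

definition SL2R :: "(real^2^2) monoid" where
  "SL2R = \<lparr>carrier = {A. det A = 1}, monoid.mult = (**), one = mat 1\<rparr>"

definition PSL2R :: "(real^2^2) set monoid" where
  "PSL2R = SL2R Mod {mat 1, - mat 1}"

definition PSL2R_topology :: "(real^2^2) set topology" where
  "PSL2R_topology =
     quotient_topology (top_of_set (carrier SL2R)) (\<lambda>A. {mat 1, - mat 1} #>\<^bsub>SL2R\<^esub> A)"

text \<open>The universal cover of a topological group \<open>G\<close> (with topology \<open>T\<close>), as a group: homotopy
  classes, relative to the endpoints, of paths issuing from the identity, multiplied pointwise. The
  covering map sends a class to its endpoint.\<close>

definition universal_cover :: "'g monoid \<Rightarrow> 'g topology \<Rightarrow> (real \<Rightarrow> 'g) set monoid" where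
  "universal_cover G T =
     \<lparr>carrier = path_class T ` {p. pathin T p \<and> p 0 = \<one>\<^bsub>G\<^esub>},
      monoid.mult = (\<lambda>C D. \<Union>p\<in>C. \<Union>q\<in>D. path_class T (\<lambda>t. p t \<otimes>\<^bsub>G\<^esub> q t)),
      one = path_class T (\<lambda>_. \<one>\<^bsub>G\<^esub>)\<rparr>"

definition cover_proj :: "(real \<Rightarrow> 'g) set \<Rightarrow> 'g" where
  "cover_proj C = (THE g. \<forall>p\<in>C. p 1 = g)"

abbreviation PSL2R_cover :: "(real \<Rightarrow> (real^2^2) set) set monoid" where
  "PSL2R_cover \<equiv> universal_cover PSL2R PSL2R_topology"

section \<open>The representation space and the obstruction class\<close>

text \<open>\<open>A 0, \<dots>, A (k - 1)\<close> are generators of \<open>\<Gamma>\<close>. Homomorphisms are taken to be extensional,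
  so that two of them agreeing on \<open>carrier \<Gamma>\<close> are equal.\<close>

definition Hom_space ::
  "('g, 'm) monoid_scheme \<Rightarrow> nat \<Rightarrow> (nat \<Rightarrow> 'g) \<Rightarrow> 'h monoid \<Rightarrow> 'h topology \<Rightarrow> ('g \<Rightarrow> 'h) topology"
  where
  "Hom_space \<Gamma> k A G T =
     pullback_topology (hom \<Gamma> G \<inter> extensional (carrier \<Gamma>))
       (\<lambda>\<phi>. \<lambda>i\<in>{..<k}. \<phi> (A i)) (product_topology (\<lambda>_. T) {..<k})"

definition list_mult :: "('g, 'm) monoid_scheme \<Rightarrow> 'g list \<Rightarrow> 'g" where
  "list_mult G xs = foldr (\<lambda>x y. x \<otimes>\<^bsub>G\<^esub> y) xs \<one>\<^bsub>G\<^esub>"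

text \<open>\<open>z\<close> is a generator of the kernel of the universal cover, \<open>a i\<close> a lift of \<open>\<phi> (A i)\<close>.\<close>

definition obstruction_class ::
  "(real \<Rightarrow> (real^2^2) set) set \<Rightarrow> nat \<Rightarrow> (nat \<Rightarrow> 'g) \<Rightarrow> ('g \<Rightarrow> (real^2^2) set) \<Rightarrow> bit" where
  "obstruction_class z k A \<phi> =
     (THE n. \<exists>a N. (\<forall>i<k. a i \<in> carrier PSL2R_cover \<and> cover_proj (a i) = \<phi> (A i)) \<and>
        list_mult PSL2R_cover (map (\<lambda>i. a i [^]\<^bsub>PSL2R_cover\<^esub> (2::nat)) [0..<k])
          = z [^]\<^bsub>PSL2R_cover\<^esub> (N::int) \<and>
        n = of_int N)"

definition obstruction_class_pi0 ::
  "(real \<Rightarrow> (real^2^2) set) set \<Rightarrow> nat \<Rightarrow> (nat \<Rightarrow> 'g) \<Rightarrow> ('g \<Rightarrow> (real^2^2) set) set \<Rightarrow> bit" where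
  "obstruction_class_pi0 z k A C = (THE n. \<forall>\<phi>\<in>C. obstruction_class z k A \<phi> = n)"

end

theory Submission
  imports Defs
begin

text \<open>The obstruction class is a sign in \<open>SL(2,\<real>)\<close>. Choose matrices \<open>X\<^sub>i\<close> over the images of the
  generators; they are determined up to sign, so \<open>X\<^sub>1\<^sup>2 \<cdots> X\<^sub>k\<^sup>2 = \<plusminus> 1\<close> depends only on the representation.
  A path in \<open>PSL(2,\<real>)\<close> issuing from the identity lifts to \<open>SL(2,\<real>)\<close>, and the endpoint of the lift
  defines a homomorphism \<open>to_SL2R\<close> from the universal cover to \<open>SL(2,\<real>)\<close>. The half circle of rotations is an
  element of the kernel of the universal cover that goes to \<open>- 1\<close>; hence every generator \<open>z\<close> of
  that kernel goes to \<open>- 1\<close>, and \<open>o\<^sub>2\<close> is the exponent of the sign (\<open>obstruction_class_eq\<close>). The sign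
  depends continuously on the representation, so \<open>o\<^sub>2\<close> is constant on connected sets, and the theorem says that the tuples with
  \<open>X\<^sub>1\<^sup>2 \<cdots> X\<^sub>k\<^sup>2 = 1\<close>, and likewise those with \<open>X\<^sub>1\<^sup>2 \<cdots> X\<^sub>k\<^sup>2 = - 1\<close>, form a connected set once
  the signs of the \<open>X\<^sub>i\<close> are forgotten.

  The point is to work with the squares \<open>Y\<^sub>i = X\<^sub>i\<^sup>2\<close>. By the Cayley-Hamilton theorem a matrix of determinant 1
  and trace greater than \<open>- 2\<close> has exactly two square roots of determinant 1, \<open>\<plusminus> (Y + 1) / sqrt (tr Y + 2)\<close>, and \<open>- 1\<close> is
  the only other square. So, away from \<open>- 1\<close>, moving the representation
  is the same as moving the \<open>Y\<^sub>i\<close> in the region \<open>tr > - 2\<close> with constant product. All the moves change two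
  neighbours \<open>P, Q\<close> with \<open>PQ = W\<close> fixed, most of them by moving one factor along the normalized segment
  towards \<open>1\<close> or \<open>- 1\<close>; then the other factor moves along the normalized segment towards \<open>W\<close> or \<open>- W\<close>,
  so that only two affine functions have to be kept above a bound (\<open>shrink_right\<close>).

  Two facts are proved in this way. If \<open>x\<^sup>2 y\<^sup>2 = h\<^sup>2\<close>, then \<open>(x, y)\<close> deforms to \<open>(h, 1)\<close>
  (\<open>deform_pair_to_square\<close>). And every triple deforms, with the product of its squares fixed, so that the squares of two
  neighbours multiply to a square (\<open>triple_to_square\<close>). Applied together, they turn a tuple of
  length at least 3 into a shorter tuple followed by \<open>1\<close>; by induction every tuple of length at least 2 deforms to
  \<open>(h, 1, \<dots>, 1)\<close> for any prescribed square root \<open>h\<close> of its product of squares (\<open>deform_to_standard\<close>). With \<open>h = 1\<close>, or \<open>h\<close> the rotation by a right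
  angle, this connects all representations with the same sign.\<close>

section \<open>Two-by-two matrices\<close>

lemma mat2_eq_iff:
  "(A::real^2^2) = B \<longleftrightarrow> A$1$1 = B$1$1 \<and> A$1$2 = B$1$2 \<and> A$2$1 = B$2$1 \<and> A$2$2 = B$2$2"
  by (auto simp: vec_eq_iff forall_2)

lemma mat2_mult_entry: "((A::real^2^2) ** B)$i$j = A$i$1 * B$1$j + A$i$2 * B$2$j"
  by (simp add: matrix_matrix_mult_def sum_2)

lemma mat2_one_entry [simp]:
  "(mat 1::real^2^2)$1$1 = 1" "(mat 1::real^2^2)$1$2 = 0"
  "(mat 1::real^2^2)$2$1 = 0" "(mat 1::real^2^2)$2$2 = 1"
  by (simp_all add: mat_def)

lemma mat2_trace: "trace (A::real^2^2) = A$1$1 + A$2$2"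
  by (simp add: trace_def sum_2)

lemmas mat2_simps = mat2_eq_iff mat2_mult_entry mat2_trace det_2

lemma continuous_on_mat2I:
  fixes f :: "'a::topological_space \<Rightarrow> real^2^2"
  assumes "\<And>i j. continuous_on S (\<lambda>x. f x $ i $ j)"
  shows "continuous_on S f"
proof -
  have "continuous_on S (\<lambda>x. \<chi> i. \<chi> j. f x $ i $ j)"
    by (intro continuous_on_vec_lambda assms)
  then show ?thesis by simp
qed

lemma continuous_on_mat2_mult [continuous_intros]:
  fixes f g :: "'a::topological_space \<Rightarrow> real^2^2"
  assumes "continuous_on S f" "continuous_on S g"
  shows "continuous_on S (\<lambda>x. f x ** g x)"
  by (rule continuous_on_mat2I, unfold mat2_mult_entry) (intro continuous_intros assms)

lemma continuous_on_mat2_trace [continuous_intros]: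
  fixes f :: "'a::topological_space \<Rightarrow> real^2^2"
  assumes "continuous_on S f"
  shows "continuous_on S (\<lambda>x. trace (f x))"
  unfolding mat2_trace by (intro continuous_intros assms)

lemma mat2_minus_mult [simp]:
  fixes A B :: "real^2^2"
  shows "(- A) ** B = - (A ** B)" "A ** (- B) = - (A ** B)"
  by (simp_all add: mat2_simps algebra_simps)

lemma mat2_det_minus [simp]: "det (- (A::real^2^2)) = det A"
  by (simp add: det_2)

lemma mat2_trace_minus [simp]: "trace (- (A::real^2^2)) = - trace A"
  by (simp add: mat2_trace)

lemma mat2_trace_scaleR [simp]: "trace (c *\<^sub>R (A::real^2^2)) = c * trace A"
  by (simp add: mat2_trace algebra_simps)

lemma mat2_trace_one [simp]: "trace (mat 1 :: real^2^2) = 2"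
  by (simp add: mat2_trace)

lemma mat2_mult_scaleR [simp]:
  fixes A B :: "real^2^2"
  shows "(c *\<^sub>R A) ** B = c *\<^sub>R (A ** B)" "A ** (c *\<^sub>R B) = c *\<^sub>R (A ** B)"
  by (simp_all add: mat2_simps algebra_simps)

lemma mat2_det_scaleR [simp]: "det (c *\<^sub>R (A::real^2^2)) = c\<^sup>2 * det A"
  by (simp add: det_2 power2_eq_square algebra_simps)

lemma mat2_cayley_hamilton: "A ** A = trace A *\<^sub>R A - det A *\<^sub>R (mat 1 :: real^2^2)"
  by (simp add: mat2_simps algebra_simps)

text \<open>The adjugate serves as an inverse on determinant 1 that is visibly linear, hence continuous.\<close>

definition adjugate :: "real^2^2 \<Rightarrow> real^2^2" where
  "adjugate A = trace A *\<^sub>R mat 1 - A"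

lemma adjugate_mult:
  "adjugate A ** A = det A *\<^sub>R mat 1" "A ** adjugate A = det A *\<^sub>R mat 1"
  by (simp_all add: adjugate_def mat2_simps algebra_simps)

lemma det_adjugate [simp]: "det (adjugate A) = det A"
  by (simp add: adjugate_def mat2_simps algebra_simps)

lemma adjugate_one [simp]: "adjugate (mat 1) = mat 1"
  by (simp add: adjugate_def mat2_simps)

lemma continuous_on_adjugate [continuous_intros]:
  assumes "continuous_on S f"
  shows "continuous_on S (\<lambda>x. adjugate (f x))"
  unfolding adjugate_def by (intro continuous_intros assms)

section \<open>Square roots in SL(2,R)\<close>

lemma trace_square: "det x = 1 \<Longrightarrow> trace (x ** x) = (trace x)\<^sup>2 - 2" for x :: "real^2^2"
  by (simp add: mat2_simps power2_eq_square algebra_simps)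

lemma square_cases:
  fixes x :: "real^2^2"
  assumes "det x = 1"
  obtains "trace (x ** x) > -2" | "x ** x = - mat 1"
proof (cases "trace x = 0")
  case True
  then have "x ** x = - mat 1"
    using assms mat2_cayley_hamilton[of x] by simp
  then show ?thesis using that by blast
next
  case False
  then have "(trace x)\<^sup>2 > 0" by simp
  then show ?thesis using that trace_square[OF assms] by simp
qed

definition sqrt_mat :: "real^2^2 \<Rightarrow> real^2^2" where
  "sqrt_mat Y = (1 / sqrt (trace Y + 2)) *\<^sub>R (Y + mat 1)"

lemma
  assumes "det Y = 1" "trace Y > -2"
  shows sqrt_mat_square: "sqrt_mat Y ** sqrt_mat Y = Y"
    and det_sqrt_mat: "det (sqrt_mat Y) = 1"
proof -
  have pos: "sqrt (trace Y + 2) * sqrt (trace Y + 2) = trace Y + 2" "trace Y + 2 \<noteq> 0"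
    using assms by auto
  have d: "det (Y + mat 1) = trace Y + 2"
    using assms by (simp add: mat2_simps algebra_simps)
  have s: "(Y + mat 1) ** (Y + mat 1) = (trace Y + 2) *\<^sub>R Y"
    using assms mat2_cayley_hamilton[of Y] by (simp add: mat2_simps algebra_simps)
  show "sqrt_mat Y ** sqrt_mat Y = Y"
    unfolding sqrt_mat_def using pos by (simp add: s)
  show "det (sqrt_mat Y) = 1"
    unfolding sqrt_mat_def using pos by (simp add: d power_divide power2_eq_square)
qed

text \<open>By Cayley-Hamilton \<open>tr x \<cdot> x = x\<^sup>2 + 1\<close>, and \<open>(tr x)\<^sup>2 = tr (x\<^sup>2) + 2\<close> is nonzero; so \<open>x\<^sup>2\<close> determines \<open>x\<close> up to
  the choice of the sign of \<open>tr x\<close>.\<close>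

lemma square_root_unique:
  fixes x y :: "real^2^2"
  assumes "det x = 1" "det y = 1" "x ** x = y ** y" "trace (x ** x) > -2"
  shows "x = y \<or> x = - y"
proof -
  have "(trace x)\<^sup>2 = (trace y)\<^sup>2" and tx: "trace x \<noteq> 0"
    using trace_square[OF assms(1)] trace_square[OF assms(2)] assms(3,4) by auto
  then have "trace x = trace y \<or> trace x = - trace y"
    by (simp add: power2_eq_iff)
  moreover have "trace x *\<^sub>R x = trace y *\<^sub>R y"
    using assms(3) by (simp add: mat2_cayley_hamilton assms(1,2))
  ultimately show ?thesis
  proof (elim disjE)
    assume t: "trace x = trace y" and e: "trace x *\<^sub>R x = trace y *\<^sub>R y"
    then show ?thesis using tx by simp
  next
    assume t: "trace x = - trace y" and e: "trace x *\<^sub>R x = trace y *\<^sub>R y"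
    then have "trace x *\<^sub>R x = trace x *\<^sub>R (- y)" by simp
    then show ?thesis using tx by (metis scaleR_cancel_left)
  qed
qed

lemma continuous_on_sqrt_mat:
  assumes "continuous_on S Y" "\<And>s. s \<in> S \<Longrightarrow> trace (Y s) > -2"
  shows "continuous_on S (\<lambda>s. sqrt_mat (Y s))"
proof -
  have "sqrt (trace (Y s) + 2) \<noteq> 0" if "s \<in> S" for s
    using assms(2)[OF that] by auto
  then show ?thesis
    unfolding sqrt_mat_def by (intro continuous_intros assms(1)) auto
qed

text \<open>For matrices of determinant 1 this is the condition to have a square root of determinant 1.\<close>

definition is_square :: "real^2^2 \<Rightarrow> bool" where
  "is_square W \<longleftrightarrow> trace W > -2 \<or> W = - mat 1"

section \<open>Deformations of tuples with a fixed product of squares\<close>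

definition squares :: "(real^2^2) list \<Rightarrow> real^2^2" where
  "squares xs = foldr (\<lambda>x p. x ** x ** p) xs (mat 1)"

lemma squares_simps [simp]:
  "squares [] = mat 1" "squares (x # xs) = x ** x ** squares xs"
  by (simp_all add: squares_def)

lemma squares_append: "squares (xs @ ys) = squares xs ** squares ys"
  by (induction xs) (simp_all add: matrix_mul_assoc)

text \<open>A path of tuples is given as a tuple of paths. Closing under transitivity replaces the concatenation of
  paths, and the sign changes identify tuples that are equal in \<open>PSL(2,\<real>)\<close>.\<close>

inductive deform :: "(real^2^2) list \<Rightarrow> (real^2^2) list \<Rightarrow> bool" where
  path: "\<lbrakk>\<forall>g\<in>set gs. continuous_on {0..1} g; \<forall>g\<in>set gs. \<forall>s\<in>{0..1}. det (g s) = 1;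
     \<forall>s\<in>{0..1}. squares (map (\<lambda>g. g s) gs) = W\<rbrakk>
     \<Longrightarrow> deform (map (\<lambda>g. g 0) gs) (map (\<lambda>g. g (1::real)) gs)"
| sign: "list_all2 (\<lambda>x y. det x = 1 \<and> (y = x \<or> y = - x)) xs ys \<Longrightarrow> deform xs ys"
| trans: "\<lbrakk>deform xs ys; deform ys zs\<rbrakk> \<Longrightarrow> deform xs zs"

lemma deform_length: "deform xs ys \<Longrightarrow> length xs = length ys"
  by (induction rule: deform.induct) (auto simp: list_all2_lengthD)

lemma deform_det: "deform xs ys \<Longrightarrow> (\<forall>x\<in>set xs. det x = 1) \<and> (\<forall>y\<in>set ys. det y = 1)"
proof (induction rule: deform.induct)
  case (sign xs ys)
  then show ?case by (induction rule: list_all2_induct) auto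
qed auto

lemma squares_sign:
  "list_all2 (\<lambda>x y. det x = 1 \<and> (y = x \<or> y = - x)) xs ys \<Longrightarrow> squares ys = squares xs"
  by (induction rule: list_all2_induct) auto

lemma deform_squares: "deform xs ys \<Longrightarrow> squares ys = squares xs"
proof (induction rule: deform.induct)
  case (path gs W)
  have "squares (map (\<lambda>g. g 0) gs) = W" "squares (map (\<lambda>g. g 1) gs) = W"
    using path(3) by simp_all
  then show ?case by simp
qed (auto simp: squares_sign)

lemma deform_refl: "\<forall>x\<in>set xs. det x = 1 \<Longrightarrow> deform xs xs"
  by (rule deform.sign) (auto simp: list_all2_same)

lemma deform_append:
  assumes "deform xs ys" "\<forall>x\<in>set us. det x = 1" "\<forall>x\<in>set vs. det x = 1"
  shows "deform (us @ xs @ vs) (us @ ys @ vs)"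
  using assms(1)
proof (induction rule: deform.induct)
  case (path gs W)
  let ?gs = "map (\<lambda>u s. u) us @ gs @ map (\<lambda>u s. u) vs"
  have "deform (map (\<lambda>g. g 0) ?gs) (map (\<lambda>g. g 1) ?gs)"
    by (rule deform.path[where W = "squares us ** W ** squares vs"])
       (use path assms in \<open>auto simp: squares_append o_def matrix_mul_assoc\<close>)
  then show ?case by (simp add: o_def)
next
  case (sign xs ys)
  then show ?case using assms
    by (intro deform.sign list_all2_appendI) (auto simp: list_all2_same)
next
  case (trans xs ys zs)
  then show ?case using deform.trans by blast
qed

lemma deform_conj:
  assumes "deform xs ys" and gh: "g ** h = mat 1" "h ** g = (mat 1 :: real^2^2)"
  shows "deform (map (\<lambda>x. g ** x ** h) xs) (map (\<lambda>x. g ** x ** h) ys)"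
proof -
  have dg: "det g * det h = 1" using gh(1) by (metis det_I det_mul)
  have d: "det (g ** x ** h) = det x" for x
    using dg by (simp add: det_mul algebra_simps)
  have m: "(g ** x ** h) ** (g ** y ** h) = g ** (x ** y) ** h" for x y
    by (metis gh(2) matrix_mul_assoc matrix_mul_rid)
  have s: "squares (map (\<lambda>x. g ** x ** h) zs) = g ** squares zs ** h" for zs
    by (induction zs) (simp_all add: m gh)
  show ?thesis using assms(1)
  proof (induction rule: deform.induct)
    case (path gs W)
    let ?gs = "map (\<lambda>f s. g ** f s ** h) gs"
    have "deform (map (\<lambda>g. g 0) ?gs) (map (\<lambda>g. g 1) ?gs)"
    proof (rule deform.path[where W = "g ** W ** h"])
      show "\<forall>g\<in>set ?gs. continuous_on {0..1} g"
        using path by (auto intro!: continuous_intros)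
      show "\<forall>g\<in>set ?gs. \<forall>s\<in>{0..1}. det (g s) = 1"
        using path d by auto
      show "\<forall>s\<in>{0..1}. squares (map (\<lambda>g. g s) ?gs) = g ** W ** h"
      proof
        fix s :: real assume "s \<in> {0..1}"
        then have "squares (map (\<lambda>g. g s) gs) = W" using path by blast
        then show "squares (map (\<lambda>g. g s) ?gs) = g ** W ** h"
          using s[of "map (\<lambda>g. g s) gs"] by (simp add: o_def)
      qed
    qed
    then show ?case by (simp add: o_def)
  next
    case (sign xs ys)
    then have "list_all2 (\<lambda>x y. det x = 1 \<and> (y = x \<or> y = - x)) (map (\<lambda>x. g ** x ** h) xs) (map (\<lambda>x. g ** x ** h) ys)"
      unfolding list_all2_map1 list_all2_map2
      by (rule list_all2_mono) (auto simp: d)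
    then show ?case by (rule deform.sign)
  next
    case (trans xs ys zs)
    then show ?case using deform.trans by blast
  qed
qed

lemma continuous_on_mat2_transpose:
  fixes f :: "'a::topological_space \<Rightarrow> real^2^2"
  assumes "continuous_on S f"
  shows "continuous_on S (\<lambda>x. transpose (f x))"
  unfolding transpose_def by (intro continuous_intros assms)

lemma mat2_transpose_minus: "transpose (- A) = - transpose (A :: real^2^2)"
  by (simp add: transpose_def vec_eq_iff)

text \<open>Transposition reverses products; it turns a move of the right factor of a pair into a move of the left one.\<close>

lemma deform_transpose:
  assumes "deform xs ys"
  shows "deform (rev (map transpose xs)) (rev (map transpose ys))"
proof -
  have s: "squares (rev (map transpose zs)) = transpose (squares zs)" for zs
    by (induction zs) (simp_all add: squares_append matrix_transpose_mul matrix_mul_assoc)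
  show ?thesis using assms
  proof (induction rule: deform.induct)
    case (path gs W)
    let ?gs = "rev (map (\<lambda>f s. transpose (f s)) gs)"
    have "deform (map (\<lambda>g. g 0) ?gs) (map (\<lambda>g. g 1) ?gs)"
    proof (rule deform.path[where W = "transpose W"])
      show "\<forall>g\<in>set ?gs. continuous_on {0..1} g"
        using path by (auto intro!: continuous_on_mat2_transpose)
      show "\<forall>g\<in>set ?gs. \<forall>s\<in>{0..1}. det (g s) = 1"
        using path by (auto simp: det_transpose)
      show "\<forall>s\<in>{0..1}. squares (map (\<lambda>g. g s) ?gs) = transpose W"
      proof
        fix t :: real assume "t \<in> {0..1}"
        then have "squares (map (\<lambda>g. g t) gs) = W" using path by blast
        then show "squares (map (\<lambda>g. g t) ?gs) = transpose W"
          using s[of "map (\<lambda>g. g t) gs"] by (simp add: o_def rev_map)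
      qed
    qed
    then show ?case by (simp add: o_def rev_map)
  next
    case (sign xs ys)
    have "list_all2 (\<lambda>x y. det x = 1 \<and> (y = x \<or> y = - x)) (map transpose xs) (map transpose ys)"
      unfolding list_all2_map1 list_all2_map2
      by (rule list_all2_mono[OF sign]) (auto simp: det_transpose mat2_transpose_minus)
    then show ?case by (intro deform.sign) simp
  next
    case (trans xs ys zs)
    then show ?case using deform.trans by blast
  qed
qed

lemma deform_pairI:
  assumes "deform [x, y] [x', y']" "\<forall>z\<in>set us. det z = 1" "\<forall>z\<in>set vs. det z = 1"
  shows "deform (us @ x # y # vs) (us @ x' # y' # vs)"
  using deform_append[OF assms] by simp

lemma deform_pair_sign:
  assumes "det x = 1" "det y = 1" "x' = x \<or> x' = - x" "y' = y \<or> y' = - y"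
  shows "deform [x, y] [x', y']"
  using assms by (intro deform.sign) auto

lemma deform_pair_singles:
  assumes "deform [x] [x']" "deform [y] [y']"
  shows "deform [x, y] [x', y']"
proof -
  have "det x' = 1" "det y = 1" using assms deform_det by force+
  then show ?thesis
    using deform_append[OF assms(1), of "[]" "[y]"] deform_append[OF assms(2), of "[x']" "[]"]
      deform.trans by auto
qed

text \<open>A motion of the two squares inside the region \<open>tr > - 2\<close> is followed by a deformation of their roots, because the
  square root is continuous there.\<close>

lemma pair_path:
  fixes P Q :: "real \<Rightarrow> real^2^2"
  assumes "continuous_on {0..1} P" "continuous_on {0..1} Q"
    and "\<And>s. s \<in> {0..1} \<Longrightarrow> det (P s) = 1 \<and> det (Q s) = 1 \<and> trace (P s) > -2 \<and> trace (Q s) > -2"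
    and "\<And>s. s \<in> {0..1} \<Longrightarrow> P s ** Q s = W"
    and x: "det x = 1" "x ** x = P 0" and y: "det y = 1" "y ** y = Q 0"
  obtains x' y' where "deform [x, y] [x', y']" "det x' = 1" "det y' = 1" "x' ** x' = P 1" "y' ** y' = Q 1"
proof -
  have "deform [x, y] [sqrt_mat (P 0), sqrt_mat (Q 0)]"
  proof (rule deform_pair_sign)
    show "sqrt_mat (P 0) = x \<or> sqrt_mat (P 0) = - x"
      using assms(3)[of 0] x by (intro square_root_unique) (auto simp: sqrt_mat_square det_sqrt_mat)
    show "sqrt_mat (Q 0) = y \<or> sqrt_mat (Q 0) = - y"
      using assms(3)[of 0] y by (intro square_root_unique) (auto simp: sqrt_mat_square det_sqrt_mat)
  qed (use x y in auto)
  moreover have "deform [sqrt_mat (P 0), sqrt_mat (Q 0)] [sqrt_mat (P 1), sqrt_mat (Q 1)]"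
  proof -
    let ?gs = "[\<lambda>s. sqrt_mat (P s), \<lambda>s. sqrt_mat (Q s)]"
    have "deform (map (\<lambda>g. g 0) ?gs) (map (\<lambda>g. g 1) ?gs)"
    proof (rule deform.path[where W = W])
      show "\<forall>g\<in>set ?gs. continuous_on {0..1} g"
        using assms(1-3) by (auto intro!: continuous_on_sqrt_mat)
    qed (use assms(3,4) in \<open>auto simp: sqrt_mat_square det_sqrt_mat matrix_mul_assoc\<close>)
    then show ?thesis by simp
  qed
  ultimately have "deform [x, y] [sqrt_mat (P 1), sqrt_mat (Q 1)]"
    by (rule deform.trans)
  then show ?thesis
    using that assms(3)[of 1] by (auto simp: sqrt_mat_square det_sqrt_mat)
qed

section \<open>Moving one factor of a product towards the centre\<close>

text \<open>\<open>D\<close> is the determinant of the point at time \<open>s\<close> on the segment from a matrix of determinant 1 and trace \<open>c\<close> to the identity, and \<open>(1 - s) a + s b\<close>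
  is the trace at that time on a segment from trace \<open>a\<close> to trace \<open>b\<close>, before normalization. The bound holds since \<open>D \<ge> (1 - 2 s)\<^sup>2\<close>
  and \<open>(1 - s) a + s b \<ge> 2 (2 s - 1)\<close>.\<close>

lemma shrink_bound:
  fixes a b c s :: real
  assumes "c > -2" "a > -2" "b \<ge> 2" "0 \<le> s" "s \<le> 1"
  defines "D \<equiv> (1 - s)\<^sup>2 + s\<^sup>2 + s * (1 - s) * c"
  shows "D > 0" "(1 - s) * a + s * b > - 2 * sqrt D"
proof -
  have D: "D = (1 - 2 * s)\<^sup>2 + s * (1 - s) * (c + 2)"
    by (simp add: D_def power2_eq_square algebra_simps)
  have nn: "s * (1 - s) * (c + 2) \<ge> 0" using assms by simp
  show "D > 0"
  proof (cases "s = 1/2")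
    case True
    have "D = (c + 2) / 4" unfolding D True by (simp add: power2_eq_square)
    then show ?thesis using assms(1) by simp
  next
    case False
    then have "(1 - 2 * s)\<^sup>2 > 0" by simp
    then show ?thesis using nn D by linarith
  qed
  have "\<bar>1 - 2 * s\<bar> \<le> sqrt D"
    using nn D by (metis le_add_same_cancel1 real_sqrt_abs real_sqrt_le_iff)
  then have le: "- 2 * sqrt D \<le> (1 - s) * (-2) + s * 2" by simp
  show "(1 - s) * a + s * b > - 2 * sqrt D"
  proof (cases "s = 1")
    case True
    have "sqrt D = 1" using True by (simp add: D_def)
    then show ?thesis using True assms(3) by simp
  next
    case False
    then have "(1 - s) * (-2) < (1 - s) * a"
      using assms(2,5) by (intro mult_strict_left_mono) auto
    moreover have "s * 2 \<le> s * b"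
      using assms(3,4) by (intro mult_left_mono) auto
    ultimately show ?thesis using le by linarith
  qed
qed

text \<open>If \<open>Q\<close> moves along the segment to \<open>c = \<plusminus> 1\<close> and \<open>P\<close> along the segment to \<open>c P Q\<close>, then the product keeps its
  direction: with \<open>Q\<^sup>2 + 1 = tr Q \<cdot> Q\<close> the factor \<open>((1 - s) + s c Q) ((1 - s) Q + s c)\<close> is a multiple of \<open>Q\<close>.\<close>

lemma
  fixes P Q :: "real^2^2"
  assumes "det P = 1" "det Q = 1" "c\<^sup>2 = 1"
  shows det_pencil: "det ((1 - s) *\<^sub>R Q + (s * c) *\<^sub>R mat 1) = (1 - s)\<^sup>2 + s\<^sup>2 + s * (1 - s) * (c * trace Q)"
    and pencil_mult: "((1 - s) *\<^sub>R P + (s * c) *\<^sub>R (P ** Q)) ** ((1 - s) *\<^sub>R Q + (s * c) *\<^sub>R mat 1)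
      = ((1 - s)\<^sup>2 + s\<^sup>2 + s * (1 - s) * (c * trace Q)) *\<^sub>R (P ** Q)"
proof -
  have dQ: "Q$1$1 * Q$2$2 - Q$1$2 * Q$2$1 = 1" using assms(2) by (simp add: det_2)
  have cc: "c * c = 1" using assms(3) by (simp add: power2_eq_square)
  have "det ((1 - s) *\<^sub>R Q + (s * c) *\<^sub>R mat 1)
      = (1 - s)\<^sup>2 * (Q$1$1 * Q$2$2 - Q$1$2 * Q$2$1) + s\<^sup>2 * (c * c) + s * (1 - s) * (c * trace Q)"
    by (simp add: mat2_simps power2_eq_square algebra_simps)
  then show "det ((1 - s) *\<^sub>R Q + (s * c) *\<^sub>R mat 1) = (1 - s)\<^sup>2 + s\<^sup>2 + s * (1 - s) * (c * trace Q)"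
    by (simp add: dQ cc)
  have ch: "Q ** Q = trace Q *\<^sub>R Q - mat 1"
    using mat2_cayley_hamilton[of Q] assms(2) by simp
  have "((1 - s) *\<^sub>R mat 1 + (s * c) *\<^sub>R Q) ** ((1 - s) *\<^sub>R Q + (s * c) *\<^sub>R mat 1)
      = ((1 - s)\<^sup>2 + s\<^sup>2 * (c * c)) *\<^sub>R Q + (s * (1 - s) * c) *\<^sub>R (Q ** Q + mat 1)"
    by (simp add: mat2_simps power2_eq_square algebra_simps)
  also have "\<dots> = ((1 - s)\<^sup>2 + s\<^sup>2 + s * (1 - s) * (c * trace Q)) *\<^sub>R Q"
    by (simp add: ch cc scaleR_add_left[symmetric] mult.assoc)
  finally have q: "((1 - s) *\<^sub>R mat 1 + (s * c) *\<^sub>R Q) ** ((1 - s) *\<^sub>R Q + (s * c) *\<^sub>R mat 1)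
      = ((1 - s)\<^sup>2 + s\<^sup>2 + s * (1 - s) * (c * trace Q)) *\<^sub>R Q" .
  have "(1 - s) *\<^sub>R P + (s * c) *\<^sub>R (P ** Q) = P ** ((1 - s) *\<^sub>R mat 1 + (s * c) *\<^sub>R Q)"
    by (simp add: mat2_simps algebra_simps)
  then show "((1 - s) *\<^sub>R P + (s * c) *\<^sub>R (P ** Q)) ** ((1 - s) *\<^sub>R Q + (s * c) *\<^sub>R mat 1)
      = ((1 - s)\<^sup>2 + s\<^sup>2 + s * (1 - s) * (c * trace Q)) *\<^sub>R (P ** Q)"
    by (simp add: matrix_mul_assoc[symmetric] q)
qed

text \<open>The basic move: \<open>y\<^sup>2\<close> runs along the segment towards \<open>c = \<plusminus> 1\<close> up to time \<open>T\<close>, both squares are divided by \<open>sqrt D\<close> to keep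
  determinant 1, and the bounds say that both traces stay above \<open>- 2\<close>.\<close>

lemma shrink_right:
  fixes x y :: "real^2^2" and c T :: real
  assumes xy: "det x = 1" "det y = 1" and c: "c\<^sup>2 = 1" and T: "0 \<le> T"
  defines "p \<equiv> trace (x ** x)" and "q \<equiv> trace (y ** y)"
    and "w \<equiv> trace (x ** x ** (y ** y))"
    and "D \<equiv> \<lambda>s. (1 - s)\<^sup>2 + s\<^sup>2 + s * (1 - s) * (c * trace (y ** y))"
  assumes bound: "\<And>s. \<lbrakk>0 \<le> s; s \<le> T\<rbrakk> \<Longrightarrow> D s > 0 \<and> (1 - s) * p + s * (c * w) > -2 * sqrt (D s)
      \<and> (1 - s) * q + s * (2 * c) > -2 * sqrt (D s)"
  obtains x' y' where "deform [x, y] [x', y']" "det x' = 1" "det y' = 1"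
    "x' ** x' = (1 / sqrt (D T)) *\<^sub>R ((1 - T) *\<^sub>R (x ** x) + (T * c) *\<^sub>R (x ** x ** (y ** y)))"
    "y' ** y' = (1 / sqrt (D T)) *\<^sub>R ((1 - T) *\<^sub>R (y ** y) + (T * c) *\<^sub>R mat 1)"
proof -
  define P where "P s = (1 / sqrt (D s)) *\<^sub>R ((1 - s) *\<^sub>R (x ** x) + (s * c) *\<^sub>R (x ** x ** (y ** y)))" for s
  define Q where "Q s = (1 / sqrt (D s)) *\<^sub>R ((1 - s) *\<^sub>R (y ** y) + (s * c) *\<^sub>R mat 1)" for s
  have dd: "det (x ** x) = 1" "det (y ** y) = 1" using xy by (simp_all add: det_mul)
  have main: "det (P s) = 1 \<and> det (Q s) = 1 \<and> trace (P s) > -2 \<and> trace (Q s) > -2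
      \<and> P s ** Q s = x ** x ** (y ** y)" if s: "0 \<le> s" "s \<le> T" for s
  proof -
    have pos: "D s > 0" and b: "(1 - s) * p + s * (c * w) > -2 * sqrt (D s)"
      "(1 - s) * q + s * (2 * c) > -2 * sqrt (D s)" using bound[OF s] by auto
    have r: "sqrt (D s) > 0" "sqrt (D s) * sqrt (D s) = D s" "(sqrt (D s))\<^sup>2 = D s" using pos by auto
    have dQ: "det (Q s) = 1"
      using det_pencil[OF dd c] pos r by (simp add: Q_def D_def power_divide)
    have PQ: "P s ** Q s = x ** x ** (y ** y)"
    proof -
      have "P s ** Q s = (1 / (sqrt (D s) * sqrt (D s))) *\<^sub>R (((1 - s) *\<^sub>R (x ** x) + (s * c) *\<^sub>R (x ** x ** (y ** y)))
         ** ((1 - s) *\<^sub>R (y ** y) + (s * c) *\<^sub>R mat 1))"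
        by (simp add: P_def Q_def)
      also have "\<dots> = (1 / D s) *\<^sub>R (D s *\<^sub>R (x ** x ** (y ** y)))"
        using pencil_mult[OF dd c, of s] r by (simp add: D_def)
      finally show ?thesis using pos by simp
    qed
    have "det (P s) * det (Q s) = 1"
      using PQ dd by (metis det_mul mult_1)
    then have dP: "det (P s) = 1" using dQ by simp
    have "trace (P s) = ((1 - s) * p + s * (c * w)) / sqrt (D s)"
      by (simp add: P_def p_def w_def trace_add add_divide_distrib)
    moreover have "trace (Q s) = ((1 - s) * q + s * (2 * c)) / sqrt (D s)"
      by (simp add: Q_def q_def trace_add add_divide_distrib)
    ultimately show ?thesis using dP dQ PQ b r by (simp add: pos_less_divide_eq)
  qed
  have cont: "continuous_on {0..T} D" unfolding D_def by (intro continuous_intros)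
  have nz: "sqrt (D s) \<noteq> 0" if "s \<in> {0..T}" for s using bound[of s] that by auto
  have cP: "continuous_on {0..T} P" and cQ: "continuous_on {0..T} Q"
    unfolding P_def Q_def using nz by (auto intro!: continuous_intros cont)
  have im: "(\<lambda>t. T * t) ` {0..1} \<subseteq> {0..T}"
    using T by (auto simp: mult_left_le)
  have P0: "P 0 = x ** x" "Q 0 = y ** y" by (simp_all add: P_def Q_def D_def)
  show ?thesis
  proof (rule pair_path[of "\<lambda>t. P (T * t)" "\<lambda>t. Q (T * t)" "x ** x ** (y ** y)" x y])
    show "continuous_on {0..1} (\<lambda>t. P (T * t))" "continuous_on {0..1} (\<lambda>t. Q (T * t))"
      by (rule continuous_on_compose2[OF cP _ im] continuous_on_compose2[OF cQ _ im]; intro continuous_intros)+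
    fix s :: real assume "s \<in> {0..1}"
    then have "0 \<le> T * s" "T * s \<le> T" using T by (simp_all add: mult_left_le)
    then show "det (P (T * s)) = 1 \<and> det (Q (T * s)) = 1 \<and> trace (P (T * s)) > -2 \<and> trace (Q (T * s)) > -2"
      "P (T * s) ** Q (T * s) = x ** x ** (y ** y)" using main by auto
  next
    fix x' y' assume "deform [x, y] [x', y']" "det x' = 1" "det y' = 1"
      "x' ** x' = P (T * 1)" "y' ** y' = Q (T * 1)"
    then show thesis using that by (simp add: P_def Q_def)
  qed (use xy P0 in auto)
qed

lemma deform_transpose_pair:
  assumes "deform [transpose y, transpose x] [y', x']"
  shows "deform [x, y] [transpose x', transpose y']"
  using deform_transpose[OF assms] by simp

lemma mat2_trace_transpose [simp]: "trace (transpose (A :: real^2^2)) = trace A"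
  by (simp add: mat2_trace transpose_def)

lemma transpose_square: "transpose x ** transpose x = transpose (x ** (x :: real^2^2))"
  by (simp add: matrix_transpose_mul)

lemma mat2_transpose_linear [simp]:
  fixes A B :: "real^2^2"
  shows "transpose (A + B) = transpose A + transpose B" "transpose (A - B) = transpose A - transpose B"
    "transpose (c *\<^sub>R A) = c *\<^sub>R transpose A"
  by (simp_all add: transpose_def vec_eq_iff)

text \<open>Moving \<open>Q = y\<^sup>2\<close> towards 1 drags \<open>P = x\<^sup>2\<close> towards the product, whose trace is at most \<open>- 2\<close>; so if \<open>P\<close> has
  trace at least 2, then on the way its trace passes through 0. A matrix \<open>Q\<close> of trace less than 2 keeps this property, because
  \<open>((1 - s) q + 2 s)\<^sup>2 < 4 D\<close> is equivalent to \<open>q\<^sup>2 < 4\<close> for \<open>s < 1\<close>.\<close>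

lemma make_left_elliptic:
  fixes x y :: "real^2^2"
  assumes xy: "det x = 1" "det y = 1"
    and tr: "trace (x ** x) > -2" "trace (y ** y) > -2" "trace (x ** x ** (y ** y)) \<le> -2"
  obtains x' y' where "deform [x, y] [x', y']" "\<bar>trace (x' ** x')\<bar> < 2" "trace (y' ** y') > -2"
    "trace (y ** y) < 2 \<Longrightarrow> trace (y' ** y') < 2"
proof (cases "trace (x ** x) < 2")
  case True
  then show ?thesis
    using that[of x y] tr deform_refl[of "[x, y]"] xy by auto
next
  case False
  define p q w where "p = trace (x ** x)" and "q = trace (y ** y)" and "w = trace (x ** x ** (y ** y))"
  \<comment> \<open>The time at which the trace of the moving left factor vanishes.\<close>
  define T where "T = p / (p - w)"
  define D where "D s = (1 - s)\<^sup>2 + s\<^sup>2 + s * (1 - s) * q" for s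
  have pqw: "p \<ge> 2" "q > -2" "w \<le> -2" using False tr by (auto simp: p_def q_def w_def)
  have T: "0 < T" "T < 1" using pqw by (auto simp: T_def field_simps)
  have T0: "(1 - T) * p + T * w = 0" using pqw by (simp add: T_def field_simps)
  have bound: "D s > 0" "(1 - s) * q + s * 2 > -2 * sqrt (D s)" "(1 - s) * p + s * w \<ge> 0"
    if "0 \<le> s" "s \<le> T" for s
  proof -
    show "D s > 0" "(1 - s) * q + s * 2 > -2 * sqrt (D s)"
      using shrink_bound[of q q 2 s] pqw that T by (auto simp: D_def)
    have "(1 - s) * p + s * w = p - s * (p - w)" by (simp add: algebra_simps)
    also have "\<dots> \<ge> p - T * (p - w)" using that pqw by (intro diff_left_mono mult_right_mono) auto
    also have "p - T * (p - w) = 0" using T0 by (simp add: algebra_simps)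
    finally show "(1 - s) * p + s * w \<ge> 0" .
  qed
  obtain x' y' where d: "deform [x, y] [x', y']" and
    x': "x' ** x' = (1 / sqrt (D T)) *\<^sub>R ((1 - T) *\<^sub>R (x ** x) + T *\<^sub>R (x ** x ** (y ** y)))" and
    y': "y' ** y' = (1 / sqrt (D T)) *\<^sub>R ((1 - T) *\<^sub>R (y ** y) + T *\<^sub>R mat 1)"
  proof (rule shrink_right[OF xy, of 1 T])
    fix s :: real assume s: "0 \<le> s" "s \<le> T"
    have "sqrt (D s) > 0" using bound(1)[OF s] by simp
    then have "(1 - s) * p + s * w > -2 * sqrt (D s)"
      using bound(3)[OF s] by linarith
    then have "D s > 0 \<and> (1 - s) * p + s * w > -2 * sqrt (D s) \<and> (1 - s) * q + s * 2 > -2 * sqrt (D s)"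
      using bound(1,2)[OF s] by simp
    then show "(1 - s)\<^sup>2 + s\<^sup>2 + s * (1 - s) * (1 * trace (y ** y)) > 0 \<and>
        (1 - s) * trace (x ** x) + s * (1 * trace (x ** x ** (y ** y))) > -2 * sqrt ((1 - s)\<^sup>2 + s\<^sup>2 + s * (1 - s) * (1 * trace (y ** y))) \<and>
        (1 - s) * trace (y ** y) + s * (2 * 1) > -2 * sqrt ((1 - s)\<^sup>2 + s\<^sup>2 + s * (1 - s) * (1 * trace (y ** y)))"
      by (simp add: D_def p_def q_def w_def)
  qed (use T that in \<open>auto simp: D_def q_def\<close>)
  have r: "sqrt (D T) > 0" using bound(1)[of T] T by simp
  have "trace (x' ** x') = (1 / sqrt (D T)) * ((1 - T) * p + T * w)"
    unfolding x' p_def w_def by (simp add: trace_add add_divide_distrib)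
  then have "trace (x' ** x') = 0" using T0 by simp
  moreover have ty: "trace (y' ** y') = ((1 - T) * q + T * 2) / sqrt (D T)"
    unfolding y' q_def by (simp add: trace_add add_divide_distrib)
  then have "trace (y' ** y') > -2"
    using bound(2)[of T] T r by (simp add: pos_less_divide_eq)
  moreover have "trace (y' ** y') < 2" if "q < 2"
  proof -
    have "(1 - T) * q + T * 2 < 2 * sqrt (D T)"
    proof (rule power2_less_imp_less)
      have "q\<^sup>2 < 2\<^sup>2" using that pqw(2) by (intro power2_strict_mono) auto
      then have "(1 - T)\<^sup>2 * q\<^sup>2 < (1 - T)\<^sup>2 * 4" using T by (intro mult_strict_left_mono) auto
      then show "((1 - T) * q + T * 2)\<^sup>2 < (2 * sqrt (D T))\<^sup>2"
        using bound(1)[of T] T by (simp add: D_def power_mult_distrib power2_eq_square algebra_simps)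
    qed (use r in auto)
    then show ?thesis using ty r by (simp add: pos_divide_less_eq)
  qed
  ultimately show ?thesis using that[OF d] by (simp add: q_def)
qed

lemma make_right_elliptic:
  fixes x y :: "real^2^2"
  assumes xy: "det x = 1" "det y = 1"
    and tr: "trace (x ** x) > -2" "trace (y ** y) > -2" "trace (x ** x ** (y ** y)) \<le> -2"
  obtains x' y' where "deform [x, y] [x', y']" "trace (x' ** x') > -2" "\<bar>trace (y' ** y')\<bar> < 2"
    "trace (x ** x) < 2 \<Longrightarrow> trace (x' ** x') < 2"
proof -
  have w: "transpose y ** transpose y ** (transpose x ** transpose x) = transpose (x ** x ** (y ** y))"
    by (simp add: matrix_transpose_mul matrix_mul_assoc)
  show ?thesis
  proof (rule make_left_elliptic[of "transpose y" "transpose x"])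
    fix y' x' assume *: "deform [transpose y, transpose x] [y', x']" "\<bar>trace (y' ** y')\<bar> < 2" "trace (x' ** x') > -2"
      "trace (transpose x ** transpose x) < 2 \<Longrightarrow> trace (x' ** x') < 2"
    show thesis
      using * by (intro that[OF deform_transpose_pair[OF *(1)]]) (auto simp: transpose_square)
  qed (use assms w in \<open>auto simp: transpose_square det_transpose\<close>)
qed

section \<open>Two neighbours of a triple can be made to multiply to a square\<close>

lemma mat2_mult_diff: "A ** (B - C) = A ** B - A ** (C :: real^2^2)" for A :: "real^2^2"
  by (simp add: mat2_simps algebra_simps)

text \<open>A matrix \<open>x\<close> with \<open>x\<^sup>2 = - 1\<close> behaves like the imaginary unit; this is \<open>(x e\<^bsup>- x s\<^esup>)\<^sup>2 = - e\<^bsup>- 2 x s\<^esup>\<close>.\<close>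

lemma half_turn_rotate:
  fixes x Y :: "real^2^2"
  assumes x: "det x = 1" "x ** x = - mat 1"
  shows "(cos s *\<^sub>R x + sin s *\<^sub>R mat 1) ** (cos s *\<^sub>R x + sin s *\<^sub>R mat 1)
      = - cos (2 * s) *\<^sub>R mat 1 + sin (2 * s) *\<^sub>R x" (is "?e ** ?e = _")
    and "det (cos s *\<^sub>R x + sin s *\<^sub>R mat 1) = 1"
proof -
  have "?e ** ?e = (cos s)\<^sup>2 *\<^sub>R (x ** x) + (2 * sin s * cos s) *\<^sub>R x + (sin s)\<^sup>2 *\<^sub>R mat 1"
    by (simp add: mat2_simps power2_eq_square algebra_simps)
  then show "?e ** ?e = - cos (2 * s) *\<^sub>R mat 1 + sin (2 * s) *\<^sub>R x"
    unfolding x(2) cos_double sin_double by (simp add: algebra_simps)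
  have t: "trace x = 0"
    using trace_square[OF x(1)] x(2) by simp
  have "det ?e = (cos s)\<^sup>2 * det x + sin s * cos s * trace x + (sin s)\<^sup>2"
    by (simp add: mat2_simps power2_eq_square algebra_simps)
  then show "det ?e = 1" by (simp add: x t)
qed

text \<open>The root formula breaks down at \<open>x\<^sup>2 = - 1\<close>, so here \<open>x\<close> itself is moved, along the rotations
  about its centre. The sign of \<open>x\<close> decides in which direction \<open>x\<^sup>2\<close> leaves \<open>- 1\<close>; it is chosen such that
  the trace of the other square, \<open>cos 2s \<cdot> tr Y + sin 2s \<cdot> tr (u Y)\<close>, stays nonnegative.\<close>

lemma leave_half_turn:
  fixes x y :: "real^2^2"
  assumes xy: "det x = 1" "det y = 1" and x: "x ** x = - mat 1" and ty: "trace (y ** y) \<ge> 0"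
  obtains x' y' where "deform [x, y] [x', y']" "trace (x' ** x') > -2" "trace (y' ** y') > -2"
proof -
  define Y where "Y = y ** y"
  have dY: "det Y = 1" using xy by (simp add: Y_def det_mul)
  obtain u where u: "u = x \<or> u = - x" "trace (u ** Y) \<ge> 0"
  proof (cases "trace (x ** Y) \<ge> 0")
    case False
    then show ?thesis using that[of "- x"] by simp
  qed (use that in auto)
  have du: "det u = 1" and uu: "u ** u = - mat 1" using u xy x by auto
  define X where "X s = cos s *\<^sub>R u + sin s *\<^sub>R mat 1" for s
  define Z where "Z s = cos (2 * s) *\<^sub>R Y + sin (2 * s) *\<^sub>R (u ** Y)" for s
  have dX: "det (X s) = 1" for s
    unfolding X_def by (rule half_turn_rotate(2)[OF du uu])
  have XX: "X s ** X s = - cos (2 * s) *\<^sub>R mat 1 + sin (2 * s) *\<^sub>R u" for s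
    unfolding X_def by (rule half_turn_rotate(1)[OF du uu])
  have XXZ: "X s ** X s ** Z s = - Y" for s
  proof -
    have "X s ** X s ** Z s = - ((cos (2 * s))\<^sup>2 *\<^sub>R Y) + (sin (2 * s))\<^sup>2 *\<^sub>R (u ** u ** Y)"
      unfolding XX Z_def by (simp add: mat2_simps power2_eq_square algebra_simps)
    also have "\<dots> = - (((cos (2 * s))\<^sup>2 + (sin (2 * s))\<^sup>2) *\<^sub>R Y)"
      unfolding uu scaleR_left_distrib by simp
    finally show ?thesis by (simp only: sin_cos_squared_add2 scaleR_one)
  qed
  have dZ: "det (Z s) = 1" for s
  proof -
    have "det (X s ** X s ** Z s) = 1" by (simp add: XXZ dY)
    then show ?thesis by (simp add: det_mul dX)
  qed
  \<comment> \<open>On this range \<open>cos 2s\<close> and \<open>sin 2s\<close> are nonnegative, and at its end the square of \<open>X s\<close> has trace 0.\<close>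
  have tZ: "trace (Z s) > -2" if "s \<in> {0..pi/4}" for s
  proof -
    have "cos (2 * s) \<ge> 0" "sin (2 * s) \<ge> 0"
      using that by (auto intro!: cos_ge_zero sin_ge_zero)
    then have "trace (Z s) \<ge> 0"
      using ty u(2) by (simp add: Z_def trace_add Y_def)
    then show ?thesis by simp
  qed
  have "deform [x, y] [X 0, sqrt_mat (Z 0)]"
  proof (rule deform_pair_sign)
    have "trace (y ** y) > -2" using ty by simp
    then show "sqrt_mat (Z 0) = y \<or> sqrt_mat (Z 0) = - y"
      using xy dY by (intro square_root_unique) (auto simp: sqrt_mat_square det_sqrt_mat Z_def Y_def)
  qed (use u xy in \<open>auto simp: X_def\<close>)
  moreover have "deform [X 0, sqrt_mat (Z 0)] [X (pi/4), sqrt_mat (Z (pi/4))]"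
  proof -
    let ?gs = "[\<lambda>s. X (pi/4 * s), \<lambda>s. sqrt_mat (Z (pi/4 * s))]"
    have r: "pi/4 * s \<in> {0..pi/4}" if "s \<in> {0..1}" for s
      using that by (auto simp: mult_left_le)
    have cZ: "continuous_on {0..1} (\<lambda>s. Z (pi/4 * s))"
      unfolding Z_def by (intro continuous_intros)
    have "deform (map (\<lambda>g. g 0) ?gs) (map (\<lambda>g. g 1) ?gs)"
    proof (rule deform.path[where W = "- Y"])
      have "continuous_on {0..1} (\<lambda>s. sqrt_mat (Z (pi/4 * s)))"
        by (rule continuous_on_sqrt_mat[OF cZ]) (rule tZ[OF r])
      moreover have "continuous_on {0..1} (\<lambda>s. X (pi/4 * s))"
        unfolding X_def by (intro continuous_intros)
      ultimately show "\<forall>g\<in>set ?gs. continuous_on {0..1} g" by simp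
      show "\<forall>g\<in>set ?gs. \<forall>s\<in>{0..1}. det (g s) = 1"
        using tZ r dZ by (auto simp: dX intro!: det_sqrt_mat)
      show "\<forall>s\<in>{0..1}. squares (map (\<lambda>g. g s) ?gs) = - Y"
        using tZ r dZ by (auto simp: sqrt_mat_square XXZ)
    qed
    then show ?thesis by simp
  qed
  ultimately have "deform [x, y] [X (pi/4), sqrt_mat (Z (pi/4))]"
    by (rule deform.trans)
  moreover have "trace (X (pi/4) ** X (pi/4)) > -2"
    unfolding XX using trace_square[OF du] uu by (simp add: trace_add)
  moreover have "trace (sqrt_mat (Z (pi/4)) ** sqrt_mat (Z (pi/4))) > -2"
    using tZ[of "pi/4"] by (simp add: sqrt_mat_square dZ)
  ultimately show ?thesis by (rule that)
qed

lemma leave_half_turns: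
  fixes x y :: "real^2^2"
  assumes xy: "det x = 1" "det y = 1" and ns: "\<not> is_square (x ** x ** (y ** y))"
  obtains x' y' where "deform [x, y] [x', y']" "trace (x' ** x') > -2" "trace (y' ** y') > -2"
proof (rule square_cases[OF xy(1)])
  assume x: "x ** x = - mat 1"
  then have "trace (y ** y) \<ge> 2" using ns by (simp add: is_square_def)
  then have "trace (y ** y) \<ge> 0" by simp
  then show ?thesis using leave_half_turn[OF xy x] that by metis
next
  assume x: "trace (x ** x) > -2"
  show ?thesis
  proof (rule square_cases[OF xy(2)])
    assume "trace (y ** y) > -2"
    then show ?thesis using x xy by (intro that[of x y] deform_refl) auto
  next
    assume y: "y ** y = - mat 1"
    have "trace (x ** x) \<ge> 2" using y ns by (simp add: is_square_def)
    show ?thesis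
    proof (rule leave_half_turn[of "transpose y" "transpose x"])
      fix y' x' assume *: "deform [transpose y, transpose x] [y', x']"
        "trace (y' ** y') > -2" "trace (x' ** x') > -2"
      show thesis
        by (rule that[OF deform_transpose_pair[OF *(1)]]) (use * in \<open>auto simp: transpose_square\<close>)
    qed (use xy y \<open>trace (x ** x) \<ge> 2\<close> in \<open>auto simp: det_transpose transpose_square mat2_transpose_minus\<close>)
  qed
qed

text \<open>Here \<open>y\<^sup>2\<close> is moved towards \<open>- 1\<close> with \<open>y\<^sup>2 w\<^sup>2\<close> fixed. The trace of \<open>w\<^sup>2\<close> stays above \<open>- 2\<close> because \<open>w\<^sup>2\<close> is
  dragged towards \<open>- y\<^sup>2 w\<^sup>2\<close>, of trace at least 2. The product \<open>x\<^sup>2 y\<^sup>2\<close> is dragged towards \<open>- x\<^sup>2\<close>, whose trace exceeds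
  \<open>- 2\<close>, so shortly before the end it is a square.\<close>

lemma make_pair_square:
  fixes x y w :: "real^2^2"
  assumes d: "det x = 1" "det y = 1" "det w = 1"
    and x: "trace (x ** x) < 2" and y: "\<bar>trace (y ** y)\<bar> < 2" and w: "trace (w ** w) > -2"
    and yw: "trace (y ** y ** (w ** w)) \<le> -2"
  obtains y' w' where "deform [y, w] [y', w']" "trace (x ** x ** (y' ** y')) > -2"
proof -
  define q where "q = trace (y ** y)"
  define p where "p = trace (x ** x)"
  define v where "v = trace (x ** x ** (y ** y))"
  define D where "D s = (1 - s)\<^sup>2 + s\<^sup>2 + s * (1 - s) * (- q)" for s :: real
  have q2: "q\<^sup>2 < 4" using y abs_less_iff[of q 2] power2_strict_mono[of q 2] by (simp add: q_def)
  have D1: "D 1 = 1" by (simp add: D_def)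
  \<comment> \<open>Positivity of \<open>f s\<close> says that the trace of the product of the first two squares exceeds \<open>- 2\<close> at time \<open>s\<close>.\<close>
  define f where "f s = (1 - s) * v - s * p + 2 * sqrt (D s)" for s
  have "isCont f 1"
    unfolding f_def D_def by (intro continuous_intros)
  then have "(f \<longlongrightarrow> f 1) (at_left 1)"
    by (simp add: isCont_def filterlim_at_split)
  moreover have "f 1 > 0" using x by (simp add: f_def D1 p_def)
  ultimately have "\<forall>\<^sub>F s in at_left 1. f s > 0"
    by (rule order_tendstoD(1))
  moreover have "\<forall>\<^sub>F s::real in at_left 1. s \<in> {0<..<1}"
    by (rule eventually_at_left_real) simp
  ultimately have "\<forall>\<^sub>F s in at_left 1. f s > 0 \<and> s \<in> {0<..<1}"
    by (rule eventually_conj)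
  then obtain T where T: "f T > 0" "0 < T" "T < 1"
    using eventually_happens'[of "at_left (1::real)"] by (auto simp: trivial_limit_at_left_real)
  have dt: "det (transpose w) = 1" "det (transpose y) = 1" using d by (auto simp: det_transpose)
  have "transpose w ** transpose w ** (transpose y ** transpose y) = transpose (y ** y ** (w ** w))"
    by (simp add: matrix_transpose_mul matrix_mul_assoc)
  then have tt: "trace (transpose w ** transpose w) = trace (w ** w)"
    "trace (transpose y ** transpose y) = trace (y ** y)"
    "trace (transpose w ** transpose w ** (transpose y ** transpose y)) = trace (y ** y ** (w ** w))"
    by (simp_all add: transpose_square)
  have pos: "D s > 0" and bw: "(1 - s) * trace (w ** w) - s * trace (y ** y ** (w ** w)) > - 2 * sqrt (D s)"
    if "0 \<le> s" "s \<le> T" for s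
    using shrink_bound[of "- q" "trace (w ** w)" "- trace (y ** y ** (w ** w))" s] that T y w yw
    by (auto simp: D_def q_def)
  have bq: "(1 - s) * q - 2 * s > - 2 * sqrt (D s)" if s: "0 \<le> s" "s \<le> T" for s
  proof (rule ccontr)
    assume "\<not> ?thesis"
    then have "2 * sqrt (D s) \<le> 2 * s - (1 - s) * q" by simp
    then have "(2 * sqrt (D s))\<^sup>2 \<le> (2 * s - (1 - s) * q)\<^sup>2"
      using pos[OF s] by (intro power_mono) auto
    then have "4 * D s \<le> (2 * s - (1 - s) * q)\<^sup>2"
      using pos[OF s] by (simp add: power_mult_distrib)
    then have "(1 - s)\<^sup>2 * 4 \<le> (1 - s)\<^sup>2 * q\<^sup>2"
      by (simp add: D_def power2_eq_square algebra_simps)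
    then show False using q2 s T by simp
  qed
  \<comment> \<open>Transposition makes \<open>y\<close> the right factor, which is the one that \<open>shrink_right\<close> moves.\<close>
  show ?thesis
  proof (rule shrink_right[OF dt, of "-1" T])
    fix s :: real assume s: "0 \<le> s" "s \<le> T"
    show "(1 - s)\<^sup>2 + s\<^sup>2 + s * (1 - s) * (- 1 * trace (transpose y ** transpose y)) > 0 \<and>
       (1 - s) * trace (transpose w ** transpose w) + s * (- 1 * trace (transpose w ** transpose w ** (transpose y ** transpose y)))
         > - 2 * sqrt ((1 - s)\<^sup>2 + s\<^sup>2 + s * (1 - s) * (- 1 * trace (transpose y ** transpose y))) \<and>
       (1 - s) * trace (transpose y ** transpose y) + s * (2 * - 1)
         > - 2 * sqrt ((1 - s)\<^sup>2 + s\<^sup>2 + s * (1 - s) * (- 1 * trace (transpose y ** transpose y)))"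
      unfolding tt
      using pos[OF s] bw[OF s] bq[OF s] by (simp add: D_def q_def)
  next
    fix w' y' :: "real^2^2"
    assume df: "deform [transpose w, transpose y] [w', y']"
      and y': "y' ** y' = (1 / sqrt ((1 - T)\<^sup>2 + T\<^sup>2 + T * (1 - T) * (- 1 * trace (transpose y ** transpose y)))) *\<^sub>R
        ((1 - T) *\<^sub>R (transpose y ** transpose y) + (T * - 1) *\<^sub>R mat 1)"
    have y'': "transpose y' ** transpose y' = (1 / sqrt (D T)) *\<^sub>R ((1 - T) *\<^sub>R (y ** y) - T *\<^sub>R mat 1)"
      unfolding transpose_square y'[unfolded tt(2) transpose_square] by (simp add: D_def q_def)
    have r: "sqrt (D T) > 0" using pos[of T] T by simp
    have "x ** x ** (transpose y' ** transpose y') = (1 / sqrt (D T)) *\<^sub>R ((1 - T) *\<^sub>R (x ** x ** (y ** y)) - T *\<^sub>R (x ** x))"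
      unfolding y'' by (simp add: mat2_mult_diff)
    then have "trace (x ** x ** (transpose y' ** transpose y')) = ((1 - T) * v - T * p) / sqrt (D T)"
      by (simp add: trace_sub v_def p_def diff_divide_distrib)
    also have "\<dots> > -2" using T(1) r by (simp add: f_def pos_less_divide_eq)
    finally show thesis
      using that[OF deform_transpose_pair[OF df]] by simp
  qed (use T in auto)
qed

text \<open>As long as no two neighbours multiply to a square, both products of neighbours have trace at most \<open>- 2\<close>. Then all squares
  can be moved off \<open>- 1\<close>, the first two can be made elliptic, and the previous lemma applies.\<close>

lemma triple_to_square:
  fixes x y w :: "real^2^2"
  assumes d: "det x = 1" "det y = 1" "det w = 1"
  obtains x' y' w' where "deform [x, y, w] [x', y', w']"
    "is_square (x' ** x' ** (y' ** y')) \<or> is_square (y' ** y' ** (w' ** w'))"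
proof -
  have L: "deform [a, b, w] [a', b', w]" if "deform [a, b] [a', b']" "det w = 1" for a b a' b' w
    using deform_pairI[OF that(1), of "[]" "[w]"] that by simp
  have R: "deform [a, b, w] [a, b', w']" if "deform [b, w] [b', w']" "det a = 1" for a b b' w w'
    using deform_pairI[OF that(1), of "[a]" "[]"] that by simp
  show ?thesis
  proof (cases "is_square (y ** y ** (w ** w))")
    case True
    then show ?thesis using that deform_refl[of "[x, y, w]"] d by simp
  next
    case False
    obtain y1 w1 where 1: "deform [y, w] [y1, w1]" "trace (y1 ** y1) > -2" "trace (w1 ** w1) > -2"
      using leave_half_turns[OF d(2,3) False] .
    have d1: "det y1 = 1" "det w1 = 1" using deform_det[OF 1(1)] by auto
    note D1 = R[OF 1(1) d(1)]
    show ?thesis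
    proof (cases "is_square (x ** x ** (y1 ** y1))")
      case True
      then show ?thesis using that[OF D1] by simp
    next
      case ns: False
      obtain x2 y2 where 2: "deform [x, y1] [x2, y2]" "trace (x2 ** x2) > -2" "trace (y2 ** y2) > -2"
        using leave_half_turns[OF d(1) d1(1) ns] .
      have d2: "det x2 = 1" "det y2 = 1" using deform_det[OF 2(1)] by auto
      have e2: "x2 ** x2 ** (y2 ** y2) = x ** x ** (y1 ** y1)"
        using deform_squares[OF 2(1)] by simp
      have t: "trace (x ** x ** (y1 ** y1)) \<le> -2" using ns by (auto simp: is_square_def)
      obtain x3 y3 where 3: "deform [x2, y2] [x3, y3]" "\<bar>trace (x3 ** x3)\<bar> < 2" "trace (y3 ** y3) > -2"
        by (rule make_left_elliptic[OF d2 2(2,3)]) (use e2 t that in auto)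
      have d3: "det x3 = 1" "det y3 = 1" using deform_det[OF 3(1)] by auto
      have e3: "x3 ** x3 ** (y3 ** y3) = x ** x ** (y1 ** y1)"
        using deform_squares[OF 3(1)] e2 by simp
      obtain x4 y4 where 4: "deform [x3, y3] [x4, y4]" "trace (x4 ** x4) < 2" "\<bar>trace (y4 ** y4)\<bar> < 2"
      proof (rule make_right_elliptic[OF d3])
        show "trace (x3 ** x3) > -2" "trace (y3 ** y3) > -2" "trace (x3 ** x3 ** (y3 ** y3)) \<le> -2"
          using 3 e3 t by auto
      qed (use that 3 in auto)
      have d4: "det x4 = 1" "det y4 = 1" using deform_det[OF 4(1)] by auto
      have D4: "deform [x, y, w] [x4, y4, w1]"
        by (rule deform.trans[OF deform.trans[OF deform.trans[OF D1 L[OF 2(1) d1(2)]] L[OF 3(1) d1(2)]] L[OF 4(1) d1(2)]])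
      show ?thesis
      proof (cases "is_square (y4 ** y4 ** (w1 ** w1))")
        case True
        then show ?thesis using that[OF D4] by simp
      next
        case False
        then have "trace (y4 ** y4 ** (w1 ** w1)) \<le> -2" by (auto simp: is_square_def)
        then obtain y5 w5 where 5: "deform [y4, w1] [y5, w5]" "trace (x4 ** x4 ** (y5 ** y5)) > -2"
          using make_pair_square[OF d4 d1(2) 4(2,3) 1(3)] by blast
        then show ?thesis
          using that[OF deform.trans[OF D4 R[OF 5(1) d4(1)]]] by (simp add: is_square_def)
      qed
    qed
  qed
qed

section \<open>Rotations and half turns\<close>

definition rot :: "real \<Rightarrow> real^2^2" where
  "rot a = vector [vector [cos a, - sin a], vector [sin a, cos a]]"

lemma rot_entry [simp]:
  "rot a $ 1 $ 1 = cos a" "rot a $ 1 $ 2 = - sin a" "rot a $ 2 $ 1 = sin a" "rot a $ 2 $ 2 = cos a"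
  by (simp_all add: rot_def)

lemma rot_mult: "rot a ** rot b = rot (a + b)"
  by (simp add: mat2_simps cos_add sin_add algebra_simps)

lemma det_rot [simp]: "det (rot a) = 1"
  by (simp add: det_2 power2_eq_square[symmetric])

lemma rot_0: "rot 0 = mat 1"
  by (simp add: mat2_eq_iff)

lemma rot_pi: "rot pi = - mat 1"
  by (simp add: mat2_eq_iff)

lemma continuous_on_rot [continuous_intros]:
  assumes "continuous_on S f" shows "continuous_on S (\<lambda>s. rot (f s))"
proof -
  have "continuous_on UNIV rot"
  proof (rule continuous_on_mat2I)
    fix i j :: 2
    show "continuous_on UNIV (\<lambda>x. rot x $ i $ j)"
      by (cases i rule: exhaust_2[THEN disjE]; cases j rule: exhaust_2[THEN disjE])
         (auto intro!: continuous_intros)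
  qed
  then show ?thesis using assms continuous_on_compose2 by blast
qed

lemma rot_eq_sign:
  assumes "rot (2 * a) = rot (2 * b)" shows "rot a = rot b \<or> rot a = - rot b"
proof -
  have "rot (2 * (a - b)) = mat 1"
    using assms rot_mult[of "2 * a" "- 2 * b"] rot_mult[of "2 * b" "- 2 * b"] by (simp add: rot_0 algebra_simps)
  then have "cos (2 * (a - b)) = 1" by (metis rot_entry(1) mat2_one_entry(1))
  then have s: "sin (a - b) = 0" unfolding cos_double_sin by simp
  then have "(cos (a - b))\<^sup>2 = 1" using sin_cos_squared_add[of "a - b"] by simp
  then have "cos (a - b) = 1 \<or> cos (a - b) = -1" by (simp add: power2_eq_1_iff)
  then have "rot (a - b) = mat 1 \<or> rot (a - b) = - mat 1"
    using s by (auto simp: mat2_eq_iff)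
  then show ?thesis
    using rot_mult[of "a - b" b] by auto
qed

lemma deform_rotations:
  assumes "rot (2 * a) ** rot (2 * b) = rot (2 * c)"
  shows "deform [rot a, rot b] [rot c, mat 1]"
proof -
  let ?gs = "[\<lambda>s. rot (a + s * b), \<lambda>s. rot (b - s * b)]"
  have "deform (map (\<lambda>g. g 0) ?gs) (map (\<lambda>g. g 1) ?gs)"
  proof (rule deform.path[where W = "rot (2 * c)"])
    show "\<forall>g\<in>set ?gs. continuous_on {0..1} g"
      by (auto intro!: continuous_intros)
    show "\<forall>s\<in>{0..1}. squares (map (\<lambda>g. g s) ?gs) = rot (2 * c)"
      using assms by (auto simp: rot_mult algebra_simps)
  qed simp
  then have "deform [rot a, rot b] [rot (a + b), mat 1]" by (simp add: rot_0)
  moreover have "rot c = rot (a + b) \<or> rot c = - rot (a + b)"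
    using assms by (intro rot_eq_sign) (simp add: rot_mult algebra_simps)
  then have "deform [rot (a + b), mat 1] [rot c, mat 1]"
    by (intro deform_pair_sign) auto
  ultimately show ?thesis by (rule deform.trans)
qed

lemma half_turn_entries:
  fixes x :: "real^2^2"
  assumes "det x = 1" "x ** x = - mat 1"
  shows "x$2$2 = - x$1$1" "x$2$1 \<noteq> 0" "x$1$2 = - (1 + (x$1$1)\<^sup>2) / x$2$1"
proof -
  have "trace x = 0" using trace_square[OF assms(1)] assms(2) by simp
  then show 1: "x$2$2 = - x$1$1" by (simp add: mat2_trace)
  have 2: "- (x$1$1)\<^sup>2 - x$1$2 * x$2$1 = 1"
    using assms(1) by (simp add: det_2 1 power2_eq_square)
  show 3: "x$2$1 \<noteq> 0"
  proof
    assume "x$2$1 = 0"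
    then have "(x$1$1)\<^sup>2 = -1" using 2 by simp
    then show False using zero_le_power2[of "x$1$1"] by linarith
  qed
  show "x$1$2 = - (1 + (x$1$1)\<^sup>2) / x$2$1"
    using 2 3 by (simp add: field_simps)
qed

text \<open>Up to sign a matrix with \<open>x\<^sup>2 = - 1\<close> has positive lower left entry \<open>c\<close>, and is then determined by \<open>c\<close> and the upper
  left entry \<open>a\<close>. So modulo sign these matrices form a half plane, the hyperbolic plane of the centres of half turns.\<close>

lemma deform_half_turns:
  fixes x y :: "real^2^2"
  assumes x: "det x = 1" "x ** x = - mat 1" and y: "det y = 1" "y ** y = - mat 1"
  shows "deform [x] [y]"
proof -
  define M where "M a c = (vector [vector [a, - (1 + a\<^sup>2) / c], vector [c, - a]] :: real^2^2)" for a c :: real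
  have M: "M a c $ 1 $ 1 = a" "M a c $ 1 $ 2 = - (1 + a\<^sup>2) / c" "M a c $ 2 $ 1 = c" "M a c $ 2 $ 2 = - a" for a c
    by (simp_all add: M_def)
  have norm: "\<exists>a c. c > 0 \<and> (M a c = u \<or> M a c = - u)" if u: "det u = 1" "u ** u = - mat 1" for u
  proof (cases "u$2$1 > 0")
    case True
    then show ?thesis using half_turn_entries[OF u]
      by (intro exI[of _ "u$1$1"] exI[of _ "u$2$1"]) (simp add: mat2_eq_iff M)
  next
    case False
    then show ?thesis using half_turn_entries[OF u]
      by (intro exI[of _ "- u$1$1"] exI[of _ "- u$2$1"]) (simp add: mat2_eq_iff M)
  qed
  obtain a c where a: "c > 0" "M a c = x \<or> M a c = - x" using norm[OF x] by blast
  obtain a' c' where a': "c' > 0" "M a' c' = y \<or> M a' c' = - y" using norm[OF y] by blast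
  let ?g = "\<lambda>s. M ((1 - s) * a + s * a') ((1 - s) * c + s * c')"
  have pos: "(1 - s) * c + s * c' > 0" if "s \<in> {0..1}" for s
  proof (cases "s = 1")
    case False
    then have "(1 - s) * c > 0" "s * c' \<ge> 0" using that a a' by auto
    then show ?thesis by linarith
  qed (use a' in simp)
  have dM: "det (M a c) = 1" "M a c ** M a c = - mat 1" if "c > 0" for a c
    using that by (simp_all add: mat2_simps M power2_eq_square)
  have "deform (map (\<lambda>g. g 0) [?g]) (map (\<lambda>g. g 1) [?g])"
  proof (rule deform.path[where W = "- mat 1"])
    have "continuous_on {0..1} ?g"
    proof (rule continuous_on_mat2I)
      fix i j :: 2
      have nz: "(1 - s) * c + s * c' \<noteq> 0" if "s \<in> {0..1}" for s using pos[OF that] by simp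
      have "i = 1 \<or> i = 2" "j = 1 \<or> j = 2" by (rule exhaust_2)+
      then show "continuous_on {0..1} (\<lambda>s. ?g s $ i $ j)"
        using nz by (elim disjE) (simp_all add: M, (intro continuous_intros | simp)+)
    qed
    then show "\<forall>g\<in>set [?g]. continuous_on {0..1} g" by simp
  qed (use pos dM in auto)
  then have "deform [M a c] [M a' c']" by simp
  moreover have "deform [x] [M a c]" "deform [M a' c'] [y]"
    using a(2) a'(2) x y by (auto intro!: deform.sign)
  ultimately show ?thesis using deform.trans by blast
qed

lemma rot_half_pi: "rot (pi/2) ** rot (pi/2) = - mat 1"
  by (simp add: rot_mult rot_pi)

section \<open>Factorizations of a square into two squares\<close>

lemma sqrt_of_rot:
  assumes "det x = 1" "x ** x = rot a" "trace (x ** x) > -2"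
  shows "rot (a/2) = x \<or> rot (a/2) = - x"
  using assms by (intro square_root_unique) (auto simp: rot_mult)

text \<open>Write \<open>P = x\<^sup>2\<close> as \<open>C + S\<close> with \<open>C\<close> commuting and \<open>S\<close> anticommuting with the rotations. Then \<open>C\<close> carries the whole trace
  of \<open>P\<close> and of \<open>P\<^sup>-\<^sup>1\<close> times a rotation. Letting \<open>S\<close> tend to 0 and rescaling \<open>C\<close> to keep determinant 1 multiplies both
  traces by a factor \<open>t \<le> 1\<close>, which keeps them above \<open>- 2\<close>, and ends in a rotation.\<close>

lemma elliptic_to_rotation:
  fixes x y :: "real^2^2"
  assumes x: "det x = 1" and y: "det y = 1"
    and tr: "trace (x ** x) > -2" "trace (y ** y) > -2"
    and R: "x ** x ** (y ** y) = rot a"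
  obtains b where "deform [x, y] [rot b, rot (a/2 - b)]"
proof -
  define P where "P = x ** x"
  define c where "c = (P$1$1 + P$2$2) / 2"
  define d where "d = (P$2$1 - P$1$2) / 2"
  define u where "u = (P$1$1 - P$2$2) / 2"
  define v where "v = (P$2$1 + P$1$2) / 2"
  define r where "r = 1 + u\<^sup>2 + v\<^sup>2"
  have dP: "det P = 1" using x by (simp add: P_def det_mul)
  have Pe: "P$1$1 = c + u" "P$1$2 = v - d" "P$2$1 = v + d" "P$2$2 = c - u"
    by (simp_all add: c_def d_def u_def v_def field_simps)
  have cd: "c\<^sup>2 + d\<^sup>2 = r"
    using dP by (simp add: det_2 Pe r_def power2_eq_square algebra_simps)
  have r: "r \<ge> 1" by (simp add: r_def)
  define t where "t s = sqrt ((1 + (1 - s)\<^sup>2 * (u\<^sup>2 + v\<^sup>2)) / r)" for s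
  define X where "X s = (vector [vector [t s * c + (1 - s) * u, (1 - s) * v - t s * d],
      vector [(1 - s) * v + t s * d, t s * c - (1 - s) * u]] :: real^2^2)" for s
  define Y where "Y s = adjugate (X s) ** rot a" for s
  have Xe: "X s $ 1 $ 1 = t s * c + (1 - s) * u" "X s $ 1 $ 2 = (1 - s) * v - t s * d"
     "X s $ 2 $ 1 = (1 - s) * v + t s * d" "X s $ 2 $ 2 = t s * c - (1 - s) * u" for s
    by (simp_all add: X_def)
  have tt: "(t s)\<^sup>2 * r = 1 + (1 - s)\<^sup>2 * (u\<^sup>2 + v\<^sup>2)" for s
    using r by (simp add: t_def)
  have dX: "det (X s) = 1" for s
  proof -
    have "det (X s) = (t s)\<^sup>2 * (c\<^sup>2 + d\<^sup>2) - (1 - s)\<^sup>2 * (u\<^sup>2 + v\<^sup>2)"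
      by (simp add: det_2 Xe power2_eq_square algebra_simps)
    then show ?thesis by (simp add: cd tt)
  qed
  have "1 + (1 - 0)\<^sup>2 * (u\<^sup>2 + v\<^sup>2) = r" by (simp add: r_def)
  then have t0: "t 0 = 1" unfolding t_def using r by simp
  have t_pos: "t s > 0" for s
  proof -
    have "1 + (1 - s)\<^sup>2 * (u\<^sup>2 + v\<^sup>2) > 0"
      by (rule add_pos_nonneg) auto
    then show ?thesis using r by (simp add: t_def)
  qed
  have t_le: "t s \<le> 1" if "s \<in> {0..1}" for s
  proof -
    have "(1 - s)\<^sup>2 \<le> 1" using that by (simp add: power_le_one)
    then have "(1 - s)\<^sup>2 * (u\<^sup>2 + v\<^sup>2) \<le> 1 * (u\<^sup>2 + v\<^sup>2)" by (intro mult_right_mono) auto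
    then have "1 + (1 - s)\<^sup>2 * (u\<^sup>2 + v\<^sup>2) \<le> r" by (simp add: r_def)
    then show ?thesis using r by (simp add: t_def)
  qed
  have X0: "X 0 = P" by (simp add: mat2_eq_iff Xe Pe t0)
  have yy: "y ** y = adjugate P ** rot a"
  proof -
    have "adjugate P ** (P ** (y ** y)) = adjugate P ** rot a" using R by (simp add: P_def)
    then show ?thesis by (simp add: matrix_mul_assoc adjugate_mult dP)
  qed
  have tX: "trace (X s) = t s * trace P" for s by (simp add: mat2_trace Xe Pe algebra_simps)
  have tY: "trace (Y s) = t s * trace (y ** y)" for s
    unfolding yy Y_def by (simp add: adjugate_def mat2_simps Xe Pe algebra_simps)
  have scale: "t s * e > -2" if "e > -2" "s \<in> {0..1}" for s e
  proof (cases "e \<ge> 0")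
    case True
    then have "t s * e \<ge> 0" using t_pos[of s] by simp
    then show ?thesis by linarith
  next
    case False
    then have "t s * e \<ge> 1 * e" using t_le[OF that(2)] by (intro mult_right_mono_neg) auto
    then show ?thesis using that by simp
  qed
  have cX: "continuous_on {0..1} X"
  proof (rule continuous_on_mat2I)
    have ct: "continuous_on {0..1} t" unfolding t_def by (intro continuous_intros)  (use r in auto)
    fix i j :: 2
    have "i = 1 \<or> i = 2" "j = 1 \<or> j = 2" by (rule exhaust_2)+
    then show "continuous_on {0..1} (\<lambda>s. X s $ i $ j)"
      by (elim disjE) (simp_all add: Xe, (intro continuous_intros ct)+)
  qed
  have cY: "continuous_on {0..1} Y" unfolding Y_def by (intro continuous_intros cX)
  have XY: "X s ** Y s = rot a" for s
    by (simp add: Y_def matrix_mul_assoc adjugate_mult dX)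
  have dY: "det (Y s) = 1" for s by (simp add: Y_def det_mul dX)
  obtain x' y' where df: "deform [x, y] [x', y']" and d': "det x' = 1" "det y' = 1"
    and e': "x' ** x' = X 1" "y' ** y' = Y 1"
  proof (rule pair_path[OF cX cY, of "rot a" x y])
    fix s :: real assume "s \<in> {0..1}"
    then show "det (X s) = 1 \<and> det (Y s) = 1 \<and> trace (X s) > -2 \<and> trace (Y s) > -2"
      using scale tr by (simp add: dX dY tX tY P_def)
  qed (use x y XY X0 yy that in \<open>auto simp: P_def Y_def\<close>)
  have t': "trace (X 1) > -2" "trace (Y 1) > -2"
    using scale tr by (simp_all add: tX tY P_def)
  have "(t 1 * c)\<^sup>2 + (t 1 * d)\<^sup>2 = (t 1)\<^sup>2 * (c\<^sup>2 + d\<^sup>2)"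
    by (simp add: power_mult_distrib algebra_simps)
  also have "\<dots> = 1" by (simp add: cd tt)
  finally obtain b where b: "t 1 * c = cos b" "t 1 * d = sin b"
    using sincos_total_2pi by metis
  have X1: "X 1 = rot b" by (simp add: mat2_eq_iff Xe b)
  have Y1: "Y 1 = rot (a - b)"
  proof -
    have "adjugate (rot b) = rot (- b)" by (simp add: mat2_eq_iff adjugate_def mat2_trace)
    then show ?thesis by (simp add: Y_def X1 rot_mult)
  qed
  have "rot (b/2) = x' \<or> rot (b/2) = - x'" "rot ((a - b)/2) = y' \<or> rot ((a - b)/2) = - y'"
    using d' e' t' by (simp_all add: sqrt_of_rot X1 Y1)
  then have "deform [x', y'] [rot (b/2), rot ((a - b)/2)]"
    using d' by (intro deform_pair_sign) auto
  then have "deform [x, y] [rot (b/2), rot (a/2 - b/2)]"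
    using deform.trans[OF df] by (simp add: diff_divide_distrib)
  then show ?thesis by (rule that)
qed

text \<open>If one of the two squares is \<open>- 1\<close>, then the other one is the rotation \<open>- rot (2 a)\<close>, and moving the half turn to the right angle
  rotation gives a pair of rotations; otherwise the preceding lemma does.\<close>

lemma deform_to_rotation:
  fixes x y :: "real^2^2"
  assumes x: "det x = 1" and y: "det y = 1"
    and R: "x ** x ** (y ** y) = rot (2 * a)" and a: "trace (rot (2 * a)) < 2"
  shows "deform [x, y] [rot a, mat 1]"
proof -
  have fin: ?thesis if "deform [x, y] [rot b, rot c]" for b c
  proof -
    have "rot (2 * b) ** rot (2 * c) = rot (2 * a)"
      using deform_squares[OF that] R by (simp add: rot_mult)
    then show ?thesis using that deform_rotations deform.trans by blast
  qed
  have neg: "- rot (2 * a) = rot (2 * a - pi)" by (simp add: mat2_eq_iff)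
  have tn: "trace (rot (2 * a - pi)) > -2" using a unfolding neg[symmetric] by simp
  have half: "deform [u] [rot (pi/2)]" if "det u = 1" "u ** u = - mat 1" for u
    using that by (intro deform_half_turns) (auto simp: rot_half_pi)
  have other: "deform [u] [rot ((2 * a - pi)/2)]" if u: "det u = 1" "u ** u = - rot (2 * a)" for u
    using sqrt_of_rot[of u "2 * a - pi"] u tn
    by (intro deform.sign) (auto simp: neg)
  show ?thesis
  proof (rule square_cases[OF x])
    assume 1: "x ** x = - mat 1"
    then have "- (y ** y) = rot (2 * a)" using R by simp
    then have "y ** y = - rot (2 * a)" by (metis minus_minus)
    then show ?thesis
      using deform_pair_singles[OF half[OF x 1] other[OF y]] fin by blast
  next
    assume tx: "trace (x ** x) > -2"
    show ?thesis
    proof (rule square_cases[OF y])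
      assume 1: "y ** y = - mat 1"
      then have "- (x ** x) = rot (2 * a)" using R by simp
      then have "x ** x = - rot (2 * a)" by (metis minus_minus)
      then show ?thesis
        using deform_pair_singles[OF other[OF x] half[OF y 1]] fin by blast
    next
      assume "trace (y ** y) > -2"
      then show ?thesis using elliptic_to_rotation[OF x y tx _ R] fin by blast
    qed
  qed
qed

text \<open>The columns of \<open>g\<close> are \<open>e\<^sub>1\<close> and \<open>N e\<^sub>1\<close>, where \<open>N\<close> is the traceless part of \<open>h\<close> scaled such that \<open>N\<^sup>2 = - 1\<close>. The determinant
  of \<open>g\<close> may be negative, which does no harm to conjugation.\<close>

lemma elliptic_conj_rot:
  fixes h :: "real^2^2"
  assumes h: "det h = 1" "\<bar>trace h\<bar> < 2"
  obtains g g' a where "g ** g' = mat 1" "g' ** g = mat 1" "h = g ** rot a ** g'"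
proof -
  define t where "t = trace h / 2"
  define s where "s = sqrt (1 - t\<^sup>2)"
  define c where "c = h$2$1"
  have "t\<^sup>2 < 1" using h(2) by (simp add: t_def abs_square_less_1)
  then have s: "s > 0" "s\<^sup>2 = 1 - t\<^sup>2" by (auto simp: s_def)
  then obtain a where a: "cos a = t" "sin a = s"
    using sincos_total_2pi[of t s] by auto
  define e where "e = h$1$1 - t"
  have he: "h$1$1 = t + e" "h$2$2 = t - e" "h$2$1 = c"
    by (simp_all add: e_def t_def c_def mat2_trace field_simps)
  have bc: "- (e\<^sup>2) - h$1$2 * c = s\<^sup>2"
    using h(1) unfolding s(2) det_2 he by (simp add: power2_eq_square algebra_simps)
  have c: "c \<noteq> 0"
  proof
    assume "c = 0"
    then have "s\<^sup>2 = - (e\<^sup>2)" using bc by simp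
    moreover have "s\<^sup>2 > 0" using s(1) by simp
    ultimately show False using zero_le_power2[of e] by linarith
  qed
  have b: "h$1$2 = - (s\<^sup>2 + e\<^sup>2) / c" using bc c by (simp add: field_simps)
  define g where "g = (vector [vector [1, e / s], vector [0, c / s]] :: real^2^2)"
  define g' where "g' = (vector [vector [1, - e / c], vector [0, s / c]] :: real^2^2)"
  have ge: "g$1$1 = 1" "g$1$2 = e / s" "g$2$1 = 0" "g$2$2 = c / s"
    "g'$1$1 = 1" "g'$1$2 = - e / c" "g'$2$1 = 0" "g'$2$2 = s / c"
    by (simp_all add: g_def g'_def)
  have "g ** g' = mat 1" "g' ** g = mat 1"
    using c s(1) by (simp_all add: mat2_simps ge)
  moreover have "h = g ** rot a ** g'"
    using c s(1) by (simp add: mat2_simps ge a he b field_simps power2_eq_square)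
  ultimately show ?thesis by (rule that)
qed

text \<open>If \<open>tr (h\<^sup>2) < 2\<close>, then \<open>h\<close> is conjugate to a rotation. If \<open>tr (h\<^sup>2) \<ge> 2\<close> and the squares avoid \<open>- 1\<close>, then \<open>y\<^sup>2\<close> can be
  moved all the way to 1. In the remaining case \<open>x\<^sup>2 = - 1\<close> or \<open>y\<^sup>2 = - 1\<close>; then the other square equals \<open>- h\<^sup>2\<close>, of trace at
  most \<open>- 2\<close>, which forces \<open>x\<^sup>2 = y\<^sup>2 = - 1\<close> and \<open>h\<^sup>2 = 1\<close>, and both half turns can be moved to the same centre.\<close>

theorem deform_pair_to_square:
  fixes x y h :: "real^2^2"
  assumes d: "det x = 1" "det y = 1" "det h = 1" and e: "x ** x ** (y ** y) = h ** h"
  shows "deform [x, y] [h, mat 1]"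
proof (cases "trace (h ** h) < 2")
  case True
  then have "(trace h)\<^sup>2 < 2\<^sup>2" using trace_square[OF d(3)] by simp
  then have "\<bar>trace h\<bar> < 2" using abs_le_square_iff[of 2 "trace h"] by auto
  then obtain g g' a where g: "g ** g' = mat 1" "g' ** g = mat 1" and h: "h = g ** rot a ** g'"
    by (rule elliptic_conj_rot[OF d(3)])
  have dg: "det g' * det g = 1" using g(2) by (metis det_I det_mul)
  have m: "(g' ** p ** g) ** (g' ** q ** g) = g' ** (p ** q) ** g" for p q
    by (metis g(1) matrix_mul_assoc matrix_mul_rid)
  have rh: "g' ** h ** g = rot a"
    unfolding h by (metis g(2) matrix_mul_assoc matrix_mul_lid matrix_mul_rid)
  have dd: "det (g' ** p ** g) = det p" for p using dg by (simp add: det_mul algebra_simps)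
  have tr: "trace (h ** h) = trace (rot (2 * a))"
    using trace_square[OF d(3)] trace_square[OF det_rot[of a]] trace_mul_sym[of "g ** rot a" g']
    by (simp add: h rot_mult matrix_mul_assoc g)
  have "deform [g' ** x ** g, g' ** y ** g] [rot a, mat 1]"
  proof (rule deform_to_rotation)
    show "g' ** x ** g ** (g' ** x ** g) ** (g' ** y ** g ** (g' ** y ** g)) = rot (2 * a)"
      using e rh m[of h h] by (simp add: m rot_mult)
  qed (use d dd tr True in auto)
  from deform_conj[OF this g]
  have "deform [g ** (g' ** x ** g) ** g', g ** (g' ** y ** g) ** g'] [h, mat 1]"
    by (simp add: h[symmetric] g)
  moreover have "g ** (g' ** p ** g) ** g' = p" for p
  proof -
    have "g ** (g' ** p ** g) ** g' = (g ** g') ** p ** (g ** g')" by (simp only: matrix_mul_assoc)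
    then show ?thesis by (simp add: g)
  qed
  ultimately show ?thesis by simp
next
  case False
  show ?thesis
  proof (rule square_cases[OF d(1)])
    assume x: "x ** x = - mat 1"
    then have y: "y ** y = - mat 1" "h ** h = mat 1"
    proof -
      have hy: "h ** h = - (y ** y)" using e x by simp
      have "trace (y ** y) \<le> -2" using False unfolding hy by simp
      then show "y ** y = - mat 1" using square_cases[OF d(2)] by fastforce
      then show "h ** h = mat 1" using e x by simp
    qed
    have "deform [x, y] [rot (pi/2), rot (pi/2)]"
      using x y d by (intro deform_pair_singles deform_half_turns) (auto simp: rot_half_pi)
    moreover have "deform [rot (pi/2), rot (pi/2)] [rot 0, mat 1]"
      by (rule deform_rotations) (simp add: rot_mult mat2_eq_iff)
    moreover have "deform [rot 0, mat 1] [h, mat 1]"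
      using square_root_unique[of h "mat 1"] d y by (intro deform_pair_sign) (auto simp: rot_0)
    ultimately show ?thesis using deform.trans by blast
  next
    assume tx: "trace (x ** x) > -2"
    show ?thesis
    proof (rule square_cases[OF d(2)])
      assume y: "y ** y = - mat 1"
      then have hx: "h ** h = - (x ** x)" using e by simp
      have False using False tx unfolding hx by simp
      then show ?thesis ..
    next
      assume ty: "trace (y ** y) > -2"
      have w: "trace (x ** x ** (y ** y)) \<ge> 2" using False e by simp
      show ?thesis
      proof (rule shrink_right[OF d(1,2), of 1 1])
        fix s :: real assume s: "0 \<le> s" "s \<le> 1"
        show "0 < (1 - s)\<^sup>2 + s\<^sup>2 + s * (1 - s) * (1 * trace (y ** y)) \<and>
          (1 - s) * trace (x ** x) + s * (1 * trace (x ** x ** (y ** y))) > - 2 * sqrt ((1 - s)\<^sup>2 + s\<^sup>2 + s * (1 - s) * (1 * trace (y ** y))) \<and>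
          (1 - s) * trace (y ** y) + s * (2 * 1) > - 2 * sqrt ((1 - s)\<^sup>2 + s\<^sup>2 + s * (1 - s) * (1 * trace (y ** y)))"
          using shrink_bound[OF ty tx w s] shrink_bound(2)[OF ty ty _ s, of 2] by simp
      next
        fix x' y' :: "real^2^2" assume df: "deform [x, y] [x', y']" and d': "det x' = 1" "det y' = 1"
         and "x' ** x' = (1 / sqrt ((1 - 1)\<^sup>2 + 1\<^sup>2 + 1 * (1 - 1) * (1 * trace (y ** y)))) *\<^sub>R ((1 - 1) *\<^sub>R (x ** x) + (1 * 1) *\<^sub>R (x ** x ** (y ** y)))"
         and "y' ** y' = (1 / sqrt ((1 - 1)\<^sup>2 + 1\<^sup>2 + 1 * (1 - 1) * (1 * trace (y ** y)))) *\<^sub>R ((1 - 1) *\<^sub>R (y ** y) + (1 * 1) *\<^sub>R mat 1)"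
        then have e': "x' ** x' = h ** h" "y' ** y' = mat 1" using e by auto
        have "h = x' \<or> h = - x'"
          by (rule square_root_unique) (use d d' e' False in auto)
        moreover have "mat 1 = y' \<or> mat 1 = - y'"
          by (rule square_root_unique) (use d d' e' in auto)
        ultimately have "deform [x', y'] [h, mat 1]" using d' by (intro deform_pair_sign)
        then show ?thesis using deform.trans[OF df] by blast
      qed auto
    qed
  qed
qed

section \<open>Reduction to a standard tuple\<close>

lemma is_square_imp_root:
  assumes "det W = 1" "is_square W"
  obtains h :: "real^2^2" where "det h = 1" "h ** h = W"
  using assms sqrt_mat_square[of W] det_sqrt_mat[of W] rot_half_pi det_rot by (metis is_square_def)

lemma deform_one_to_end:
  assumes "\<forall>z\<in>set zs. det z = 1"
  shows "deform (mat 1 # zs) (zs @ [mat 1])"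
  using assms
proof (induction zs)
  case Nil
  then show ?case by (simp add: deform_refl)
next
  case (Cons z zs)
  have "deform [mat 1, z] [z, mat 1]"
    using Cons.prems by (intro deform_pair_to_square) auto
  then have "deform (mat 1 # z # zs) (z # mat 1 # zs)"
    using deform_pairI[of "mat 1" z z "mat 1" "[]" zs] Cons.prems by simp
  moreover have "deform (z # mat 1 # zs) (z # zs @ [mat 1])"
    using deform_append[OF Cons.IH, of "[z]" "[]"] Cons.prems by simp
  ultimately have "deform (mat 1 # z # zs) (z # zs @ [mat 1])" by (rule deform.trans)
  then show ?case by simp
qed

text \<open>Two neighbours whose squares multiply to a square \<open>k\<^sup>2\<close> deform to \<open>(k, 1)\<close>, and the entry 1 is carried to the end because
  \<open>(1, z)\<close> deforms to \<open>(z, 1)\<close>, again by \<open>deform_pair_to_square\<close>. This leaves a shorter tuple.\<close>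

theorem deform_to_standard:
  assumes "\<forall>x\<in>set xs. det x = 1" "length xs \<ge> 2" "det h = 1" "squares xs = h ** h"
  shows "deform xs (h # replicate (length xs - 1) (mat 1))"
  using assms
proof (induction "length xs" arbitrary: xs rule: less_induct)
  case less
  show ?case
  proof (cases "length xs = 2")
    case True
    then obtain x y where xs: "xs = [x, y]"
      by (auto simp: numeral_2_eq_2 length_Suc_conv)
    then show ?thesis using less.prems deform_pair_to_square[of x y h] by simp
  next
    case False
    then obtain x y w vs where xs: "xs = x # y # w # vs"
      using less.prems(2) by (cases xs; cases "tl xs"; cases "tl (tl xs)") auto
    have d: "det x = 1" "det y = 1" "det w = 1" "\<forall>v\<in>set vs. det v = 1"
      using less.prems(1) xs by auto
    obtain x' y' w' where df: "deform [x, y, w] [x', y', w']"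
      and sq: "is_square (x' ** x' ** (y' ** y')) \<or> is_square (y' ** y' ** (w' ** w'))"
      using triple_to_square[OF d(1-3)] .
    have d': "det x' = 1" "det y' = 1" "det w' = 1" using deform_det[OF df] by auto
    have 1: "deform xs (x' # y' # w' # vs)"
      using deform_append[OF df, of "[]" vs] d xs by simp
    obtain us where us: "deform (x' # y' # w' # vs) (us @ [mat 1])" "length us = length xs - 1"
      "\<forall>u\<in>set us. det u = 1"
      using sq
    proof
      assume "is_square (x' ** x' ** (y' ** y'))"
      then obtain k where k: "det k = 1" "k ** k = x' ** x' ** (y' ** y')"
        using is_square_imp_root[of "x' ** x' ** (y' ** y')"] d' by (auto simp: det_mul)
      have "deform [x', y'] [k, mat 1]"
        using k d' by (intro deform_pair_to_square) auto
      then have a: "deform (x' # y' # w' # vs) (k # mat 1 # w' # vs)"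
        using deform_pairI[of x' y' k "mat 1" "[]" "w' # vs"] d d' by simp
      have b: "deform (k # mat 1 # w' # vs) (k # (w' # vs) @ [mat 1])"
        using deform_append[OF deform_one_to_end[of "w' # vs"], of "[k]" "[]"] d d' k by simp
      show thesis
        by (rule that[of "k # w' # vs"]) (use deform.trans[OF a b] d d' k xs in auto)
    next
      assume "is_square (y' ** y' ** (w' ** w'))"
      then obtain k where k: "det k = 1" "k ** k = y' ** y' ** (w' ** w')"
        using is_square_imp_root[of "y' ** y' ** (w' ** w')"] d' by (auto simp: det_mul)
      have "deform [y', w'] [k, mat 1]"
        using k d' by (intro deform_pair_to_square) auto
      then have a: "deform (x' # y' # w' # vs) (x' # k # mat 1 # vs)"
        using deform_pairI[of y' w' k "mat 1" "[x']" "vs"] d d' by simp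
      have b: "deform (x' # k # mat 1 # vs) (x' # k # vs @ [mat 1])"
        using deform_append[OF deform_one_to_end[of "vs"], of "[x', k]" "[]"] d d' k by simp
      show thesis
        by (rule that[of "x' # k # vs"]) (use deform.trans[OF a b] d d' k xs in auto)
    qed
    have 2: "deform xs (us @ [mat 1])" using deform.trans[OF 1 us(1)] .
    have "squares us = h ** h"
      using deform_squares[OF 2] less.prems(4) by (simp add: squares_append)
    then have "deform us (h # replicate (length us - 1) (mat 1))"
      using less.hyps[of us] us xs less.prems(3) by auto
    then have "deform (us @ [mat 1]) (h # replicate (length us - 1) (mat 1) @ [mat 1])"
      using deform_append[of us "h # replicate (length us - 1) (mat 1)" "[]" "[mat 1]"] by simp
    moreover have "replicate (length us - 1) (mat 1) @ [mat 1] = replicate (length xs - 1) (mat 1 :: real^2^2)"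
    proof -
      have "length xs - 1 = Suc (length us - 1)" using us(2) xs by simp
      then show ?thesis by (simp add: replicate_append_same)
    qed
    ultimately show ?thesis using deform.trans[OF 2] by simp
  qed
qed

section \<open>PSL(2,R) and lifting maps to SL(2,R)\<close>

text \<open>The point of \<open>PSL(2,\<real>)\<close> under a matrix, in the literal form used by the quotient topology.\<close>

definition proj :: "real^2^2 \<Rightarrow> (real^2^2) set" where
  "proj A = {mat 1, - mat 1} #>\<^bsub>SL2R\<^esub> A"

lemma proj_eq: "proj A = {A, - A}"
  by (auto simp: proj_def r_coset_def SL2R_def)

lemma proj_eq_iff: "proj A = proj B \<longleftrightarrow> A = B \<or> A = - B"
  by (auto simp: proj_eq doubleton_eq_iff)

lemma SL2R_simps [simp]:
  "carrier SL2R = {A. det A = 1}" "monoid.mult SL2R = (**)" "one SL2R = mat 1"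
  by (simp_all add: SL2R_def)

lemma group_SL2R: "group SL2R"
proof (rule groupI)
  fix A assume "A \<in> carrier SL2R"
  then show "\<exists>B\<in>carrier SL2R. B \<otimes>\<^bsub>SL2R\<^esub> A = \<one>\<^bsub>SL2R\<^esub>"
    by (intro bexI[of _ "adjugate A"]) (auto simp: adjugate_mult)
qed (auto simp: det_mul matrix_mul_assoc)

lemma normal_center: "{mat 1, - mat 1} \<lhd> SL2R"
proof -
  interpret group SL2R by (rule group_SL2R)
  have inv: "inv\<^bsub>SL2R\<^esub> (- mat 1) = - mat 1"
    by (rule inv_equality) auto
  have "subgroup {mat 1, - mat 1} SL2R"
    by (rule subgroupI) (auto simp: inv inv_one[simplified])
  then show ?thesis
    by (auto simp: normal_inv_iff simp del: inv_one) (simp_all add: r_inv[simplified])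
qed

lemma PSL2R_carrier: "carrier PSL2R = proj ` {A. det A = 1}"
  by (simp add: PSL2R_def carrier_FactGroup proj_def)

lemma PSL2R_one: "\<one>\<^bsub>PSL2R\<^esub> = proj (mat 1)"
  by (simp add: PSL2R_def proj_eq)

lemma PSL2R_mult:
  assumes "det A = 1" "det B = 1"
  shows "proj A \<otimes>\<^bsub>PSL2R\<^esub> proj B = proj (A ** B)"
  using normal.rcos_sum[OF normal_center, of A B] assms by (simp add: PSL2R_def proj_def)

lemma group_PSL2R: "group PSL2R"
  unfolding PSL2R_def by (rule normal.factorgroup_is_group[OF normal_center])

lemma quotient_map_proj: "quotient_map (top_of_set {A. det A = 1}) PSL2R_topology proj"
  using quotient_map_quotient_topology[of "top_of_set {A. det A = 1}" proj]
  by (simp add: PSL2R_topology_def proj_def[abs_def])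

lemma topspace_PSL2R: "topspace PSL2R_topology = proj ` {A. det A = 1}"
  using quotient_imp_surjective_map[OF quotient_map_proj] by simp

lemma continuous_map_proj:
  assumes "continuous_on S F" "\<And>x. x \<in> S \<Longrightarrow> det (F x) = 1"
  shows "continuous_map (top_of_set S) PSL2R_topology (\<lambda>x. proj (F x))"
proof -
  have "continuous_map (top_of_set S) (top_of_set {A. det A = 1}) F"
    using assms by auto
  from continuous_map_compose[OF this quotient_imp_continuous_map[OF quotient_map_proj]]
  show ?thesis by (simp add: o_def)
qed

lemma continuous_map_descend:
  assumes "continuous_on {A. det A = 1} g" "\<And>A. det A = 1 \<Longrightarrow> f (proj A) = g A"
  shows "continuous_map PSL2R_topology euclidean f"
proof (rule continuous_compose_quotient_map[OF quotient_map_proj])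
  show "continuous_map (top_of_set {A. det A = 1}) euclidean (f \<circ> proj)"
    by (rule continuous_map_eq[of _ _ g]) (use assms in auto)
qed

text \<open>Writing a matrix as a conformal plus an anticonformal linear map of the complex plane, this is twice the
  coefficient of the conformal part. It vanishes nowhere on \<open>SL(2,\<real>)\<close> and is odd, so its square is a function on \<open>PSL(2,\<real>)\<close>.\<close>

definition rot_part :: "real^2^2 \<Rightarrow> complex" where
  "rot_part A = Complex (A$1$1 + A$2$2) (A$2$1 - A$1$2)"

lemma rot_part_minus: "rot_part (- A) = - rot_part A"
  by (simp add: rot_part_def complex_eq_iff)

lemma rot_part_nonzero:
  assumes "det A = 1" shows "rot_part A \<noteq> 0"
proof
  assume "rot_part A = 0"
  then have "A$2$2 = - A$1$1" "A$2$1 = A$1$2" by (auto simp: rot_part_def complex_eq_iff)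
  then have "(A$1$1)\<^sup>2 + (A$1$2)\<^sup>2 = -1" using assms by (simp add: det_2 power2_eq_square)
  then show False using zero_le_power2[of "A$1$1"] zero_le_power2[of "A$1$2"] by linarith
qed

lemma continuous_on_rot_part [continuous_intros]:
  assumes "continuous_on S f" shows "continuous_on S (\<lambda>x. rot_part (f x))"
  unfolding rot_part_def Complex_eq by (intro continuous_intros assms)

text \<open>Lifting through the double cover amounts to choosing a square root: the square of \<open>rot_part\<close> is a nonvanishing complex
  function on \<open>PSL(2,\<real>)\<close>, and on a contractible set its composition with \<open>f\<close> has a continuous root \<open>s\<close>. The products
  of \<open>rot_part A\<close> with the entries of \<open>A\<close> also descend to \<open>PSL(2,\<real>)\<close>; dividing them by \<open>s\<close> gives the entries of \<open>A\<close> or of \<open>- A\<close>,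
  continuously.\<close>

lemma lift_to_SL2R:
  fixes S :: "'a::real_normed_vector set"
  assumes f: "continuous_map (top_of_set S) PSL2R_topology f" and S: "contractible S"
  obtains F where "continuous_on S F" "\<And>x. x \<in> S \<Longrightarrow> det (F x) = 1" "\<And>x. x \<in> S \<Longrightarrow> f x = proj (F x)"
proof -
  define r where "r C = (SOME A. A \<in> C)" for C :: "(real^2^2) set"
  have r: "r (proj A) = A \<or> r (proj A) = - A" for A
    using someI[of "\<lambda>B. B \<in> proj A" A] by (simp add: proj_eq r_def)
  define e where "e x = (rot_part (r (f x)))\<^sup>2" for x
  define V where "V i j x = rot_part (r (f x)) * of_real (r (f x) $ i $ j)" for i j x
  have e1: "(rot_part (r (proj A)))\<^sup>2 = (rot_part A)\<^sup>2" for A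
    using r[of A] by (auto simp: rot_part_minus)
  have V1: "rot_part (r (proj A)) * of_real (r (proj A) $ i $ j) = rot_part A * of_real (A $ i $ j)" for A i j
    using r[of A] by (auto simp: rot_part_minus)
  have "continuous_map PSL2R_topology euclidean (\<lambda>C. (rot_part (r C))\<^sup>2)"
    by (rule continuous_map_descend[where g = "\<lambda>A. (rot_part A)\<^sup>2"]) (auto intro!: continuous_intros e1)
  from continuous_map_compose[OF f this] have ce: "continuous_on S e"
    by (simp add: e_def o_def)
  have "continuous_map PSL2R_topology euclidean (\<lambda>C. rot_part (r C) * of_real (r C $ i $ j))" for i j
    by (rule continuous_map_descend[where g = "\<lambda>A. rot_part A * of_real (A $ i $ j)"]) (auto intro!: continuous_intros V1)
  from continuous_map_compose[OF f this] have cV: "continuous_on S (V i j)" for i j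
    by (simp add: V_def o_def)
  have fx: "\<exists>A. det A = 1 \<and> f x = proj A" if "x \<in> S" for x
  proof -
    have "f x \<in> topspace PSL2R_topology"
      using continuous_map_image_subset_topspace[OF f] that by auto
    then show ?thesis by (auto simp: topspace_PSL2R)
  qed
  have "e x \<noteq> 0" if "x \<in> S" for x
  proof -
    obtain A where "det A = 1" "f x = proj A" using fx \<open>x \<in> S\<close> by blast
    then show ?thesis by (simp add: e_def e1 rot_part_nonzero)
  qed
  then obtain s where s: "continuous_on S s" "\<And>x. x \<in> S \<Longrightarrow> e x = (s x)\<^sup>2"
    using continuous_sqrt_on_contractible[OF ce S] by metis
  define F where "F x = (\<chi> i j. Re (V i j x / s x))" for x
  have F: "det (F x) = 1 \<and> f x = proj (F x)" if x: "x \<in> S" for x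
  proof -
    obtain A where A: "det A = 1" "f x = proj A" using fx x by blast
    have "(s x)\<^sup>2 = (rot_part A)\<^sup>2" using s(2)[OF x] by (simp add: e_def A e1)
    then have "s x = rot_part A \<or> s x = - rot_part A" by (simp add: power2_eq_iff)
    moreover have "V i j x = rot_part A * of_real (A $ i $ j)" for i j by (simp add: V_def A V1)
    ultimately have "F x = A \<or> F x = - A"
      using rot_part_nonzero[OF A(1)] by (auto simp: F_def vec_eq_iff)
    then show ?thesis using A by (auto simp: proj_eq_iff)
  qed
  have "s x \<noteq> 0" if "x \<in> S" for x
    using s(2)[OF that] \<open>\<And>x. x \<in> S \<Longrightarrow> e x \<noteq> 0\<close>[OF that] by auto
  then have "continuous_on S F"
    unfolding F_def by (intro continuous_intros cV s(1)) auto
  then show ?thesis using F that by blast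
qed

text \<open>The quotient of the two values of \<open>rot_part\<close> is a continuous function with values \<open>1\<close> and \<open>- 1\<close>.\<close>

lemma lift_unique:
  fixes S :: "'a::topological_space set"
  assumes "connected S" "continuous_on S F" "continuous_on S G"
    and "\<And>x. x \<in> S \<Longrightarrow> det (F x) = 1" "\<And>x. x \<in> S \<Longrightarrow> proj (F x) = proj (G x)"
    and "a \<in> S" "F a = G a" "x \<in> S"
  shows "F x = G x"
proof -
  define q where "q x = rot_part (F x) / rot_part (G x)" for x
  have dG: "det (G x) = 1" if "x \<in> S" for x
    using assms(4,5)[OF that] by (auto simp: proj_eq_iff)
  have q: "(q x = 1 \<and> F x = G x) \<or> (q x = -1 \<and> F x = - G x)" if "x \<in> S" for x
    using assms(5)[OF that] rot_part_nonzero[OF dG[OF that]] by (auto simp: q_def proj_eq_iff rot_part_minus)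
  have "continuous_on S q"
    unfolding q_def using dG rot_part_nonzero by (auto intro!: continuous_intros assms(2,3))
  moreover have "finite (q ` S)"
    by (rule finite_subset[of _ "{1, -1}"]) (use q in auto)
  ultimately have "q constant_on S"
    using continuous_finite_range_constant[OF assms(1)] by blast
  then have "q x = q a" using assms(6,8) by (auto simp: constant_on_def)
  moreover have "q a = 1"
    using assms(7) rot_part_nonzero[OF dG[OF assms(6)]] by (simp add: q_def)
  ultimately show ?thesis using q[OF assms(8)] by auto
qed

lemma continuous_map_PSL2R_mult:
  fixes S :: "'a::real_normed_vector set"
  assumes "continuous_map (top_of_set S) PSL2R_topology f" "continuous_map (top_of_set S) PSL2R_topology g"
    and S: "contractible S"
  shows "continuous_map (top_of_set S) PSL2R_topology (\<lambda>x. f x \<otimes>\<^bsub>PSL2R\<^esub> g x)"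
proof -
  obtain F where F: "continuous_on S F" "\<And>x. x \<in> S \<Longrightarrow> det (F x) = 1" "\<And>x. x \<in> S \<Longrightarrow> f x = proj (F x)"
    using lift_to_SL2R[OF assms(1) S] by blast
  obtain G where G: "continuous_on S G" "\<And>x. x \<in> S \<Longrightarrow> det (G x) = 1" "\<And>x. x \<in> S \<Longrightarrow> g x = proj (G x)"
    using lift_to_SL2R[OF assms(2) S] by blast
  have "continuous_map (top_of_set S) PSL2R_topology (\<lambda>x. proj (F x ** G x))"
    by (rule continuous_map_proj) (use F G in \<open>auto intro!: continuous_intros simp: det_mul\<close>)
  then show ?thesis
    by (rule continuous_map_eq) (use F G in \<open>auto simp: PSL2R_mult\<close>)
qed

section \<open>The universal cover of PSL(2,R)\<close>

lemma path_homotopic_endpoints: "path_homotopic X p q \<Longrightarrow> q 0 = p 0 \<and> q 1 = p 1"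
  unfolding path_homotopic_def by (drule homotopic_with_imp_property) auto

lemma path_homotopic_refl: "pathin X p \<Longrightarrow> path_homotopic X p p"
  by (simp add: path_homotopic_def pathin_def)

lemma path_homotopic_sym:
  assumes "path_homotopic X p q" shows "path_homotopic X q p"
  using assms path_homotopic_endpoints[OF assms]
  by (simp add: path_homotopic_def homotopic_with_symD)

lemma path_homotopic_trans:
  assumes "path_homotopic X p q" "path_homotopic X q r" shows "path_homotopic X p r"
  using assms path_homotopic_endpoints[OF assms(1)]
  by (auto simp: path_homotopic_def intro: homotopic_with_trans)

lemma path_class_eq_iff:
  assumes "pathin X p" "pathin X q"
  shows "path_class X p = path_class X q \<longleftrightarrow> path_homotopic X p q"
  using assms path_homotopic_refl path_homotopic_sym path_homotopic_trans
  unfolding path_class_def by blast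

lemma path_homotopic_pathin: "path_homotopic X p q \<Longrightarrow> pathin X p \<and> pathin X q"
  unfolding path_homotopic_def pathin_def by (rule homotopic_with_imp_continuous_maps)

lemma path_homotopic_imp_class_eq: "path_homotopic X p q \<Longrightarrow> path_class X p = path_class X q"
  using path_class_eq_iff path_homotopic_pathin by blast

lemma path_homotopic_mult:
  assumes "path_homotopic PSL2R_topology p p'" "path_homotopic PSL2R_topology q q'"
  shows "path_homotopic PSL2R_topology (\<lambda>t. p t \<otimes>\<^bsub>PSL2R\<^esub> q t) (\<lambda>t. p' t \<otimes>\<^bsub>PSL2R\<^esub> q' t)"
proof -
  have sq: "prod_topology (top_of_set {0..1::real}) (top_of_set {0..1::real}) = top_of_set ({0..1} \<times> {0..1})"
    by (simp add: prod_topology_subtopology_eu)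
  obtain h where h: "continuous_map (top_of_set ({0..1::real} \<times> {0..1})) PSL2R_topology h"
    "\<forall>x. h (0, x) = p x" "\<forall>x. h (1, x) = p' x" "\<forall>t\<in>{0..1}. h (t, 0) = p 0 \<and> h (t, 1) = p 1"
    using assms(1) unfolding path_homotopic_def homotopic_with_def sq by auto
  obtain k where k: "continuous_map (top_of_set ({0..1::real} \<times> {0..1})) PSL2R_topology k"
    "\<forall>x. k (0, x) = q x" "\<forall>x. k (1, x) = q' x" "\<forall>t\<in>{0..1}. k (t, 0) = q 0 \<and> k (t, 1) = q 1"
    using assms(2) unfolding path_homotopic_def homotopic_with_def sq by auto
  have "contractible ({0..1::real} \<times> {0..1::real})"
    by (intro convex_imp_contractible convex_Times) auto
  from continuous_map_PSL2R_mult[OF h(1) k(1) this]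
  show ?thesis
    unfolding path_homotopic_def homotopic_with_def sq using h k
    by (intro exI[of _ "\<lambda>x. h x \<otimes>\<^bsub>PSL2R\<^esub> k x"]) auto
qed

text \<open>Every element of the universal cover is represented by the image of such a path, which makes the group operations matrix operations.\<close>

definition SL_paths :: "(real \<Rightarrow> real^2^2) set" where
  "SL_paths = {P. continuous_on {0..1} P \<and> (\<forall>t\<in>{0..1}. det (P t) = 1) \<and> P 0 = mat 1}"

definition lift_class :: "(real \<Rightarrow> real^2^2) \<Rightarrow> (real \<Rightarrow> (real^2^2) set) set" where
  "lift_class P = path_class PSL2R_topology (\<lambda>t. proj (P t))"

lemma pathin_SL_path: "P \<in> SL_paths \<Longrightarrow> pathin PSL2R_topology (\<lambda>t. proj (P t))"
  unfolding pathin_def SL_paths_def by (auto intro!: continuous_map_proj)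

lemma lift_class_of_path:
  assumes "pathin PSL2R_topology p" "p 0 = proj (mat 1)"
  obtains P where "P \<in> SL_paths" "\<And>t. t \<in> {0..1} \<Longrightarrow> p t = proj (P t)"
    "path_class PSL2R_topology p = lift_class P"
proof -
  have "contractible {0..1::real}" by (intro convex_imp_contractible) auto
  then obtain F where F: "continuous_on {0..1} F" "\<And>t. t \<in> {0..1} \<Longrightarrow> det (F t) = 1"
    "\<And>t. t \<in> {0..1} \<Longrightarrow> p t = proj (F t)"
    using lift_to_SL2R assms(1) unfolding pathin_def by blast
  have "F 0 = mat 1 \<or> F 0 = - mat 1"
    using F(3)[of 0] assms(2) by (auto simp: proj_eq_iff)
  then obtain P where P: "P \<in> SL_paths" "\<And>t. t \<in> {0..1} \<Longrightarrow> p t = proj (P t)"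
  proof
    assume "F 0 = - mat 1"
    then show ?thesis
      using F by (intro that[of "\<lambda>t. - F t"]) (auto simp: SL_paths_def proj_eq_iff intro!: continuous_intros)
  qed (use F that[of F] in \<open>auto simp: SL_paths_def\<close>)
  have "path_homotopic PSL2R_topology p (\<lambda>t. proj (P t))"
    unfolding path_homotopic_def
    by (rule homotopic_with_equal) (use assms P in \<open>auto simp: pathin_def\<close>)
  then have "path_class PSL2R_topology p = lift_class P"
    using path_class_eq_iff[OF assms(1) pathin_SL_path[OF P(1)]] by (simp add: lift_class_def)
  then show ?thesis using P that by blast
qed

lemma cover_carrier: "carrier PSL2R_cover = lift_class ` SL_paths"
proof
  show "carrier PSL2R_cover \<subseteq> lift_class ` SL_paths"
  proof
    fix C assume "C \<in> carrier PSL2R_cover"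
    then obtain p where "pathin PSL2R_topology p" "p 0 = proj (mat 1)" "C = path_class PSL2R_topology p"
      by (auto simp: universal_cover_def PSL2R_one)
    then show "C \<in> lift_class ` SL_paths" using lift_class_of_path by (metis imageI)
  qed
  show "lift_class ` SL_paths \<subseteq> carrier PSL2R_cover"
    using pathin_SL_path by (auto simp: universal_cover_def PSL2R_one lift_class_def SL_paths_def intro!: imageI)
qed

lemma SL_paths_mult: "P \<in> SL_paths \<Longrightarrow> Q \<in> SL_paths \<Longrightarrow> (\<lambda>t. P t ** Q t) \<in> SL_paths"
  by (auto simp: SL_paths_def det_mul intro!: continuous_intros)

lemma cover_mult:
  assumes "P \<in> SL_paths" "Q \<in> SL_paths"
  shows "lift_class P \<otimes>\<^bsub>PSL2R_cover\<^esub> lift_class Q = lift_class (\<lambda>t. P t ** Q t)"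
proof -
  let ?p = "\<lambda>t. proj (P t)" and ?q = "\<lambda>t. proj (Q t)"
  have pq: "pathin PSL2R_topology ?p" "pathin PSL2R_topology ?q" using assms pathin_SL_path by auto
  have m: "path_class PSL2R_topology (\<lambda>t. p t \<otimes>\<^bsub>PSL2R\<^esub> q t) = lift_class (\<lambda>t. P t ** Q t)"
    if "p \<in> lift_class P" "q \<in> lift_class Q" for p q
  proof -
    have 1: "path_homotopic PSL2R_topology (\<lambda>t. ?p t \<otimes>\<^bsub>PSL2R\<^esub> ?q t) (\<lambda>t. p t \<otimes>\<^bsub>PSL2R\<^esub> q t)"
      using that by (intro path_homotopic_mult) (auto simp: lift_class_def path_class_def)
    have 2: "path_homotopic PSL2R_topology (\<lambda>t. proj (P t ** Q t)) (\<lambda>t. ?p t \<otimes>\<^bsub>PSL2R\<^esub> ?q t)"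
      unfolding path_homotopic_def
    proof (rule homotopic_with_equal)
      show "continuous_map (top_of_set {0..1}) PSL2R_topology (\<lambda>t. proj (P t ** Q t))"
        using pathin_SL_path[OF SL_paths_mult[OF assms]] by (simp add: pathin_def)
    qed (use assms in \<open>auto simp: SL_paths_def PSL2R_mult\<close>)
    have "path_homotopic PSL2R_topology (\<lambda>t. proj (P t ** Q t)) (\<lambda>t. p t \<otimes>\<^bsub>PSL2R\<^esub> q t)"
      using path_homotopic_trans[OF 2 1] .
    from path_homotopic_imp_class_eq[OF this] show ?thesis by (simp add: lift_class_def)
  qed
  have "?p \<in> lift_class P" "?q \<in> lift_class Q"
    using pq by (auto simp: lift_class_def path_class_def path_homotopic_refl)
  then show ?thesis
    unfolding universal_cover_def using m by auto
qed

lemma cover_one: "\<one>\<^bsub>PSL2R_cover\<^esub> = lift_class (\<lambda>_. mat 1)"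
  by (simp add: universal_cover_def lift_class_def PSL2R_one)

lemma one_SL_paths: "(\<lambda>_. mat 1) \<in> SL_paths"
  by (simp add: SL_paths_def)

lemma group_cover: "group PSL2R_cover"
proof (rule groupI)
  show "\<one>\<^bsub>PSL2R_cover\<^esub> \<in> carrier PSL2R_cover"
    using one_SL_paths by (simp add: cover_one cover_carrier)
next
  fix C assume "C \<in> carrier PSL2R_cover"
  then obtain P where P: "P \<in> SL_paths" "C = lift_class P" by (auto simp: cover_carrier)
  show "\<one>\<^bsub>PSL2R_cover\<^esub> \<otimes>\<^bsub>PSL2R_cover\<^esub> C = C"
    using P one_SL_paths by (simp add: cover_one cover_mult)
  let ?Q = "\<lambda>t. adjugate (P t)"
  have Q: "?Q \<in> SL_paths" using P by (auto simp: SL_paths_def intro!: continuous_intros)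
  have "path_homotopic PSL2R_topology (\<lambda>t. proj (mat 1)) (\<lambda>t. proj (?Q t ** P t))"
    unfolding path_homotopic_def
    by (rule homotopic_with_equal)
       (use P pathin_SL_path[OF one_SL_paths] in \<open>auto simp: SL_paths_def adjugate_mult pathin_def\<close>)
  then have "lift_class (\<lambda>t. ?Q t ** P t) = lift_class (\<lambda>t. mat 1)"
    unfolding lift_class_def by (rule path_homotopic_imp_class_eq[symmetric])
  then have "lift_class ?Q \<otimes>\<^bsub>PSL2R_cover\<^esub> C = \<one>\<^bsub>PSL2R_cover\<^esub>"
    using P Q by (simp add: cover_mult cover_one)
  then show "\<exists>D\<in>carrier PSL2R_cover. D \<otimes>\<^bsub>PSL2R_cover\<^esub> C = \<one>\<^bsub>PSL2R_cover\<^esub>"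
    using Q by (auto simp: cover_carrier)
qed (auto simp: cover_carrier cover_mult SL_paths_mult matrix_mul_assoc)

text \<open>A homotopy relative to the endpoints lifts to the square. The lift is constant on the two sides where the
  homotopy is constant, and agrees with the two given paths on the other sides.\<close>

lemma lift_class_eq_imp_endpoint_eq:
  assumes P: "P \<in> SL_paths" and Q: "Q \<in> SL_paths" and eq: "lift_class P = lift_class Q"
  shows "P 1 = Q 1"
proof -
  have sq: "prod_topology (top_of_set {0..1::real}) (top_of_set {0..1::real}) = top_of_set ({0..1} \<times> {0..1})"
    by (simp add: prod_topology_subtopology_eu)
  have "path_homotopic PSL2R_topology (\<lambda>t. proj (P t)) (\<lambda>t. proj (Q t))"
    using eq path_class_eq_iff[OF pathin_SL_path[OF P] pathin_SL_path[OF Q]] by (simp add: lift_class_def)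
  then obtain h where h: "continuous_map (top_of_set ({0..1::real} \<times> {0..1})) PSL2R_topology h"
    "\<forall>x. h (0, x) = proj (P x)" "\<forall>x. h (1, x) = proj (Q x)"
    "\<forall>t\<in>{0..1}. h (t, 0) = proj (P 0) \<and> h (t, 1) = proj (P 1)"
    unfolding path_homotopic_def homotopic_with_def sq by auto
  have "contractible ({0..1::real} \<times> {0..1::real})"
    by (intro convex_imp_contractible convex_Times) auto
  then obtain F where F: "continuous_on ({0..1} \<times> {0..1}) F"
    "\<And>x. x \<in> {0..1} \<times> {0..1} \<Longrightarrow> det (F x) = 1" "\<And>x. x \<in> {0..1} \<times> {0..1} \<Longrightarrow> h x = proj (F x)"
    using lift_to_SL2R[OF h(1)] by blast
  have "F (0, 0) = mat 1 \<or> F (0, 0) = - mat 1"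
    using F(3)[of "(0, 0)"] h(2) P by (auto simp: proj_eq_iff SL_paths_def)
  then obtain H where H: "continuous_on ({0..1} \<times> {0..1}) H"
    "\<And>x. x \<in> {0..1} \<times> {0..1} \<Longrightarrow> det (H x) = 1" "\<And>x. x \<in> {0..1} \<times> {0..1} \<Longrightarrow> proj (H x) = h x"
    "H (0, 0) = mat 1"
  proof
    assume "F (0, 0) = - mat 1"
    then show ?thesis using F
      by (intro that[of "\<lambda>x. - F x"]) (auto simp: proj_eq_iff intro!: continuous_intros)
  qed (use F that[of F] in auto)
  have cont: "continuous_on {0..1} (\<lambda>t. H (t, b))" "continuous_on {0..1} (\<lambda>t. H (b, t))" if "b \<in> {0..1}" for b
    using that by (auto intro!: continuous_on_compose2[OF H(1)] continuous_intros)
  have conn: "connected {0..1::real}" by simp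
  have left: "H (t, 0) = mat 1" if "t \<in> {0..1}" for t
    by (rule lift_unique[OF conn cont(1)[of 0], where a = 0])
       (use that H h P in \<open>auto simp: SL_paths_def\<close>)
  have bottom: "H (0, t) = P t" if "t \<in> {0..1}" for t
    by (rule lift_unique[OF conn cont(2)[of 0], where a = 0])
       (use that H h P in \<open>auto simp: SL_paths_def\<close>)
  have top: "H (1, t) = Q t" if "t \<in> {0..1}" for t
    by (rule lift_unique[OF conn cont(2)[of 1], where a = 0])
       (use that H h Q left[of 1] in \<open>auto simp: SL_paths_def\<close>)
  have right: "H (t, 1) = P 1" if "t \<in> {0..1}" for t
    by (rule lift_unique[OF conn cont(1)[of 1], where a = 0])
       (use that H h P bottom[of 1] in \<open>auto simp: SL_paths_def\<close>)
  show ?thesis using right[of 1] top[of 1] by simp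
qed

lemma cover_proj_lift_class:
  assumes "P \<in> SL_paths" shows "cover_proj (lift_class P) = proj (P 1)"
proof -
  have 1: "(\<lambda>t. proj (P t)) \<in> lift_class P"
    using pathin_SL_path[OF assms] by (auto simp: lift_class_def path_class_def path_homotopic_refl)
  have 2: "p 1 = proj (P 1)" if "p \<in> lift_class P" for p
    using path_homotopic_endpoints[of PSL2R_topology "\<lambda>t. proj (P t)" p] that
    by (simp add: lift_class_def path_class_def)
  show ?thesis
    unfolding cover_proj_def
  proof (rule the_equality)
    fix g assume "\<forall>p\<in>lift_class P. p 1 = g"
    from bspec[OF this 1] show "g = proj (P 1)" by simp
  qed (use 2 in blast)
qed

text \<open>The intermediate covering: the endpoint of the lift is the same for all representatives of a class, by the preceding lemma.\<close>

definition to_SL2R :: "(real \<Rightarrow> (real^2^2) set) set \<Rightarrow> real^2^2" where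
  "to_SL2R C = (SOME P. P \<in> SL_paths \<and> lift_class P = C) 1"

lemma to_SL2R_lift_class:
  assumes "P \<in> SL_paths" shows "to_SL2R (lift_class P) = P 1"
proof -
  let ?Q = "SOME Q. Q \<in> SL_paths \<and> lift_class Q = lift_class P"
  have "?Q \<in> SL_paths \<and> lift_class ?Q = lift_class P"
    using assms by (intro someI[of "\<lambda>Q. Q \<in> SL_paths \<and> lift_class Q = lift_class P" P]) simp
  then show ?thesis
    using lift_class_eq_imp_endpoint_eq[of ?Q P] assms by (simp add: to_SL2R_def)
qed

lemma to_SL2R_hom: "to_SL2R \<in> hom PSL2R_cover SL2R"
  by (rule homI) (auto simp: cover_carrier cover_mult to_SL2R_lift_class SL_paths_mult, auto simp: SL_paths_def)

lemma proj_to_SL2R: "C \<in> carrier PSL2R_cover \<Longrightarrow> proj (to_SL2R C) = cover_proj C"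
  by (auto simp: cover_carrier to_SL2R_lift_class cover_proj_lift_class)

section \<open>Homomorphisms out of a presented group\<close>

definition word_value :: "('g, 'm) monoid_scheme \<Rightarrow> ('a \<Rightarrow> 'g) \<Rightarrow> ('a \<times> bool) list \<Rightarrow> 'g" where
  "word_value G g w = foldr (\<lambda>(a, b) y. (if b then g a else inv\<^bsub>G\<^esub> (g a)) \<otimes>\<^bsub>G\<^esub> y) w \<one>\<^bsub>G\<^esub>"

lemma word_value_simps [simp]:
  "word_value G g [] = \<one>\<^bsub>G\<^esub>"
  "word_value G g ((a, b) # w) = (if b then g a else inv\<^bsub>G\<^esub> (g a)) \<otimes>\<^bsub>G\<^esub> word_value G g w"
  by (simp_all add: word_value_def)

lemma words_over_simps [simp]:
  "[] \<in> words_over S" "(a, b) # w \<in> words_over S \<longleftrightarrow> a \<in> S \<and> w \<in> words_over S"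
  "u @ v \<in> words_over S \<longleftrightarrow> u \<in> words_over S \<and> v \<in> words_over S"
  by (auto simp: words_over_def)

context
  fixes G :: "('g, 'm) monoid_scheme" and g :: "'a \<Rightarrow> 'g" and S :: "'a set"
  assumes G: "group G" and g: "\<And>a. a \<in> S \<Longrightarrow> g a \<in> carrier G"
begin

interpretation group G by (rule G)

lemma word_value_closed: "w \<in> words_over S \<Longrightarrow> word_value G g w \<in> carrier G"
  by (induction w) (auto simp: g)

lemma word_value_append:
  "\<lbrakk>u \<in> words_over S; v \<in> words_over S\<rbrakk> \<Longrightarrow> word_value G g (u @ v) = word_value G g u \<otimes>\<^bsub>G\<^esub> word_value G g v"
  by (induction u) (auto simp: g word_value_closed m_assoc)

lemma word_value_equiv:
  assumes R: "R \<subseteq> words_over S" "\<And>r. r \<in> R \<Longrightarrow> word_value G g r = \<one>\<^bsub>G\<^esub>"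
    and e: "(u, v) \<in> word_equiv S R"
  shows "word_value G g u = word_value G g v"
proof -
  have red: "word_value G g u = word_value G g v" if uv: "(u, v) \<in> word_reductions S R" for u v
  proof -
    obtain p r q where *: "u = p @ r @ q" "v = p @ q" "p \<in> words_over S" "q \<in> words_over S"
      and r: "r \<in> R \<union> {[(a, b), (a, \<not> b)] | a b. a \<in> S}"
      using uv unfolding word_reductions_def by blast
    have "r \<in> words_over S \<and> word_value G g r = \<one>\<^bsub>G\<^esub>"
      using r R g by auto
    then show ?thesis using * by (simp add: word_value_append word_value_closed)
  qed
  have "(u, v) \<in> (word_reductions S R \<union> (word_reductions S R)\<inverse>)\<^sup>*"
    using e by (simp add: word_equiv_def)
  then show ?thesis
    by (induction rule: rtrancl_induct) (use red in force)+
qed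

end

lemma equiv_word_equiv: "equiv (words_over S) (word_equiv S R)"
proof (rule equivI)
  have "sym ((word_reductions S R \<union> (word_reductions S R)\<inverse>)\<^sup>*)"
    by (rule sym_rtrancl) (auto simp: sym_def)
  then show "sym (word_equiv S R)" by (auto simp: word_equiv_def sym_def)
  show "trans (word_equiv S R)"
    by (auto simp: word_equiv_def trans_def intro: rtrancl_trans)
qed (auto simp: word_equiv_def refl_on_def)

lemma word_equiv_context:
  assumes "(u, v) \<in> word_equiv S R" "p \<in> words_over S" "q \<in> words_over S"
  shows "(p @ u @ q, p @ v @ q) \<in> word_equiv S R"
proof -
  have red: "(p @ u @ q, p @ v @ q) \<in> word_reductions S R" if uv: "(u, v) \<in> word_reductions S R" for u v
  proof -
    obtain p' r q' where *: "u = p' @ r @ q'" "v = p' @ q'" "p' \<in> words_over S" "q' \<in> words_over S"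
      "r \<in> R \<union> {[(a, b), (a, \<not> b)] | a b. a \<in> S}"
      using uv unfolding word_reductions_def by blast
    then have "p @ u @ q = (p @ p') @ r @ (q' @ q)" "p @ v @ q = (p @ p') @ (q' @ q)"
      "p @ p' \<in> words_over S" "q' @ q \<in> words_over S"
      using assms by auto
    then show ?thesis using *(5) unfolding word_reductions_def by blast
  qed
  have "(u, v) \<in> (word_reductions S R \<union> (word_reductions S R)\<inverse>)\<^sup>*"
    using assms by (simp add: word_equiv_def)
  then have "(p @ u @ q, p @ v @ q) \<in> (word_reductions S R \<union> (word_reductions S R)\<inverse>)\<^sup>*"
    by (induction rule: rtrancl_induct) (auto intro: rtrancl_into_rtrancl dest: red)
  then show ?thesis using assms by (simp add: word_equiv_def)
qed

abbreviation word_class :: "'a set \<Rightarrow> ('a \<times> bool) list set \<Rightarrow> ('a \<times> bool) list \<Rightarrow> ('a \<times> bool) list set" where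
  "word_class S R u \<equiv> word_equiv S R `` {u}"

lemma presented_group_carrier: "carrier (presented_group S R) = word_class S R ` words_over S"
  by (auto simp: presented_group_def quotient_def)

lemma UN2_constant:
  assumes "a \<in> A" "b \<in> B" "\<And>x y. \<lbrakk>x \<in> A; y \<in> B\<rbrakk> \<Longrightarrow> f x y = C"
  shows "(\<Union>x\<in>A. \<Union>y\<in>B. f x y) = C"
  using assms by (fastforce simp: set_eq_iff)

lemma presented_group_mult:
  assumes "u \<in> words_over S" "v \<in> words_over S"
  shows "word_class S R u \<otimes>\<^bsub>presented_group S R\<^esub> word_class S R v = word_class S R (u @ v)"
proof -
  have m: "word_class S R (u' @ v') = word_class S R (u @ v)"
    if "u' \<in> word_class S R u" "v' \<in> word_class S R v" for u' v'
  proof -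
    have uv: "(u, u') \<in> word_equiv S R" "(v, v') \<in> word_equiv S R" using that by auto
    then have w: "u' \<in> words_over S" "v' \<in> words_over S" by (auto simp: word_equiv_def)
    have e: "(u @ v, u' @ v) \<in> word_equiv S R" "(u' @ v, u' @ v') \<in> word_equiv S R"
      using word_equiv_context[OF uv(1), of "[]" v] word_equiv_context[OF uv(2), of u' "[]"] assms w by auto
    show ?thesis
      using equiv_class_eq[OF equiv_word_equiv e(1)] equiv_class_eq[OF equiv_word_equiv e(2)] by simp
  qed
  have "u \<in> word_class S R u" "v \<in> word_class S R v"
    using equiv_class_self[OF equiv_word_equiv] assms by auto
  from UN2_constant[OF this m] show ?thesis by (simp add: presented_group_def)
qed

lemma reduction_class_eq:
  assumes "(u, v) \<in> word_reductions S R" "u \<in> words_over S" "v \<in> words_over S"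
  shows "word_class S R u = word_class S R v"
  using assms by (intro equiv_class_eq[OF equiv_word_equiv]) (auto simp: word_equiv_def)

text \<open>The homomorphism evaluates any word of a class; the value is unchanged by inserting or deleting a relator or a pair of inverse letters.\<close>

lemma presented_group_universal:
  assumes G: "group G" and g: "\<And>a. a \<in> S \<Longrightarrow> g a \<in> carrier G"
    and R: "R \<subseteq> words_over S" "\<And>r. r \<in> R \<Longrightarrow> word_value G g r = \<one>\<^bsub>G\<^esub>"
  obtains \<psi> where "\<psi> \<in> hom (presented_group S R) G" "\<And>a. a \<in> S \<Longrightarrow> \<psi> (presented_gen S R a) = g a"
proof -
  interpret group G by (rule G)
  define \<psi> where "\<psi> C = word_value G g (SOME u. u \<in> C)" for C
  have \<psi>: "\<psi> (word_class S R u) = word_value G g u" if u: "u \<in> words_over S" for u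
  proof -
    have "u \<in> word_class S R u"
      using equiv_class_self[OF equiv_word_equiv] u by auto
    then have "(SOME v. v \<in> word_class S R u) \<in> word_class S R u" by (rule someI)
    then have "(u, SOME v. v \<in> word_class S R u) \<in> word_equiv S R" by simp
    from word_value_equiv[OF G g R this] show ?thesis by (simp add: \<psi>_def)
  qed
  show ?thesis
  proof
    show "\<psi> \<in> hom (presented_group S R) G"
    proof (rule homI)
      fix C assume "C \<in> carrier (presented_group S R)"
      then show "\<psi> C \<in> carrier G"
        using word_value_closed[OF G g] by (auto simp: presented_group_carrier \<psi>)
    next
      fix C D assume "C \<in> carrier (presented_group S R)" "D \<in> carrier (presented_group S R)"
      then show "\<psi> (C \<otimes>\<^bsub>presented_group S R\<^esub> D) = \<psi> C \<otimes>\<^bsub>G\<^esub> \<psi> D"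
        using word_value_append[OF G g] by (auto simp: presented_group_carrier presented_group_mult \<psi>)
    qed
    show "\<psi> (presented_gen S R a) = g a" if "a \<in> S" for a
      using that g \<psi>[of "[(a, True)]"] by (simp add: presented_gen_def)
  qed
qed

text \<open>The class of the empty word is idempotent, so its image is the identity; the image of an inverse letter is then a
  one-sided, hence two-sided, inverse.\<close>

lemma presented_group_hom_value:
  assumes G: "group G" and \<psi>: "\<psi> \<in> hom (presented_group S R) G" and u: "u \<in> words_over S"
  shows "\<psi> (word_class S R u) = word_value G (\<lambda>a. \<psi> (presented_gen S R a)) u"
  using u
proof (induction u)
  interpret group G by (rule G)
  have cl: "\<psi> (word_class S R v) \<in> carrier G" if "v \<in> words_over S" for v
    using hom_in_carrier[OF \<psi>] that by (auto simp: presented_group_carrier)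
  have mult: "\<psi> (word_class S R (v @ w)) = \<psi> (word_class S R v) \<otimes>\<^bsub>G\<^esub> \<psi> (word_class S R w)"
    if "v \<in> words_over S" "w \<in> words_over S" for v w
    using hom_mult[OF \<psi>, of "word_class S R v" "word_class S R w"] that
    by (simp add: presented_group_carrier presented_group_mult)
  have one: "\<psi> (word_class S R []) = \<one>\<^bsub>G\<^esub>"
    using mult[of "[]" "[]"] cl[of "[]"] by (simp add: r_cancel_one')
  {
    case Nil
    show ?case using one by simp
  next
    case (Cons x u)
    obtain a b where x: "x = (a, b)" by (cases x)
    have a: "a \<in> S" and u: "u \<in> words_over S" using Cons.prems x by auto
    have "([] @ [(a, True), (a, \<not> True)] @ [], [] @ []) \<in> word_reductions S R"
      unfolding word_reductions_def using a by (intro CollectI exI conjI refl UnI2) auto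
    then have "word_class S R ([(a, True)] @ [(a, False)]) = word_class S R []"
      using a by (intro reduction_class_eq) auto
    then have "\<psi> (word_class S R [(a, True)]) \<otimes>\<^bsub>G\<^esub> \<psi> (word_class S R [(a, False)]) = \<one>\<^bsub>G\<^esub>"
      using mult[of "[(a, True)]" "[(a, False)]"] a one by simp
    then have "\<psi> (word_class S R [(a, False)]) = inv\<^bsub>G\<^esub> (\<psi> (word_class S R [(a, True)]))"
      using inv_equality[of "\<psi> (word_class S R [(a, True)])" "\<psi> (word_class S R [(a, False)])"] cl[of "[(a, True)]"] cl[of "[(a, False)]"] a
      by (metis (no_types, lifting) inv_equality inv_inv words_over_simps(1,2))
    then have "\<psi> (word_class S R [(a, b)]) = (if b then \<psi> (presented_gen S R a) else inv\<^bsub>G\<^esub> (\<psi> (presented_gen S R a)))"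
      by (cases b) (simp_all add: presented_gen_def)
    then show ?case
      using mult[of "[(a, b)]" u] Cons.IH a u by (simp add: x)
  }
qed

lemma relator_value_one:
  assumes G: "group G" and \<psi>: "\<psi> \<in> hom (presented_group S R) G" and r: "r \<in> R" "r \<in> words_over S"
  shows "word_value G (\<lambda>a. \<psi> (presented_gen S R a)) r = \<one>\<^bsub>G\<^esub>"
proof -
  have "([] @ r @ [], [] @ []) \<in> word_reductions S R"
    unfolding word_reductions_def
    by (rule CollectI, intro exI[of _ "[]"] exI[of _ r]) (use r in simp)
  then have "word_class S R r = word_class S R []"
    using r by (intro reduction_class_eq) auto
  then show ?thesis
    using presented_group_hom_value[OF G \<psi> r(2)] presented_group_hom_value[OF G \<psi>, of "[]"] by simp
qed

lemma presentation_hom_exists: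
  assumes pres: "has_presentation \<Gamma> S R A" and G: "group G" and g: "\<And>a. a \<in> S \<Longrightarrow> g a \<in> carrier G"
    and R: "R \<subseteq> words_over S" "\<And>r. r \<in> R \<Longrightarrow> word_value G g r = \<one>\<^bsub>G\<^esub>"
  obtains \<phi> where "\<phi> \<in> hom \<Gamma> G \<inter> extensional (carrier \<Gamma>)" "\<And>a. a \<in> S \<Longrightarrow> \<phi> (A a) = g a"
proof -
  let ?P = "presented_group S R"
  obtain f where f: "f \<in> iso ?P \<Gamma>" "\<And>a. a \<in> S \<Longrightarrow> f (presented_gen S R a) = A a"
    using pres by (auto simp: has_presentation_def)
  have fh: "f \<in> hom ?P \<Gamma>" and fb: "bij_betw f (carrier ?P) (carrier \<Gamma>)"
    using f(1) by (auto simp: iso_def)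
  obtain \<psi> where \<psi>: "\<psi> \<in> hom ?P G" "\<And>a. a \<in> S \<Longrightarrow> \<psi> (presented_gen S R a) = g a"
    using presented_group_universal[of G S g R, OF G g R] by blast
  define \<phi> where "\<phi> = restrict (\<lambda>x. \<psi> (inv_into (carrier ?P) f x)) (carrier \<Gamma>)"
  have \<phi>f: "\<phi> (f u) = \<psi> u" if "u \<in> carrier ?P" for u
    using that fb by (simp add: \<phi>_def bij_betw_def hom_in_carrier[OF fh])
  have img: "\<exists>u\<in>carrier ?P. x = f u" if "x \<in> carrier \<Gamma>" for x
    using that fb by (auto simp: bij_betw_def)
  have closed: "u \<otimes>\<^bsub>?P\<^esub> v \<in> carrier ?P" if "u \<in> carrier ?P" "v \<in> carrier ?P" for u v
    using that by (auto simp: presented_group_carrier presented_group_mult)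
  have "\<phi> \<in> hom \<Gamma> G"
  proof (rule homI)
    fix x assume "x \<in> carrier \<Gamma>"
    then obtain u where "u \<in> carrier ?P" "x = f u" using img by blast
    then show "\<phi> x \<in> carrier G" using hom_in_carrier[OF \<psi>(1)] by (simp add: \<phi>f)
  next
    fix x y assume "x \<in> carrier \<Gamma>" "y \<in> carrier \<Gamma>"
    then obtain u v where uv: "u \<in> carrier ?P" "v \<in> carrier ?P" "x = f u" "y = f v" using img by metis
    then have "x \<otimes>\<^bsub>\<Gamma>\<^esub> y = f (u \<otimes>\<^bsub>?P\<^esub> v)" using hom_mult[OF fh] by simp
    then show "\<phi> (x \<otimes>\<^bsub>\<Gamma>\<^esub> y) = \<phi> x \<otimes>\<^bsub>G\<^esub> \<phi> y"
      using uv closed hom_mult[OF \<psi>(1)] by (simp add: \<phi>f)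
  qed
  moreover have "\<phi> (A a) = g a" if "a \<in> S" for a
  proof -
    have "presented_gen S R a \<in> carrier ?P"
      using that by (auto simp: presented_gen_def presented_group_carrier)
    then show ?thesis using \<phi>f f(2) \<psi>(2) that by metis
  qed
  ultimately show ?thesis by (intro that[of \<phi>]) (auto simp: \<phi>_def)
qed

lemma presentation_hom:
  assumes pres: "has_presentation \<Gamma> S R A" and G: "group G" and \<phi>: "\<phi> \<in> hom \<Gamma> G"
  shows presentation_hom_carrier: "a \<in> S \<Longrightarrow> A a \<in> carrier \<Gamma>"
    and presentation_relator: "\<lbrakk>r \<in> R; R \<subseteq> words_over S\<rbrakk> \<Longrightarrow> word_value G (\<lambda>a. \<phi> (A a)) r = \<one>\<^bsub>G\<^esub>"
    and presentation_hom_unique: "\<lbrakk>\<phi>' \<in> hom \<Gamma> G; \<phi> \<in> extensional (carrier \<Gamma>);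
      \<phi>' \<in> extensional (carrier \<Gamma>); \<And>a. a \<in> S \<Longrightarrow> \<phi> (A a) = \<phi>' (A a)\<rbrakk> \<Longrightarrow> \<phi> = \<phi>'"
proof -
  let ?P = "presented_group S R"
  obtain f where f: "f \<in> iso ?P \<Gamma>" "\<And>a. a \<in> S \<Longrightarrow> f (presented_gen S R a) = A a"
    using pres by (auto simp: has_presentation_def)
  have fh: "f \<in> hom ?P \<Gamma>" and fb: "bij_betw f (carrier ?P) (carrier \<Gamma>)"
    using f(1) by (auto simp: iso_def)
  have gen: "presented_gen S R a \<in> carrier ?P" if "a \<in> S" for a
    using that by (auto simp: presented_gen_def presented_group_carrier)
  then show "A a \<in> carrier \<Gamma>" if "a \<in> S" for a
    using hom_in_carrier[OF fh] f(2) that by metis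
  have wv: "word_value G (\<lambda>a. (\<theta> \<circ> f) (presented_gen S R a)) w = word_value G (\<lambda>a. \<theta> (A a)) w"
    if "w \<in> words_over S" for \<theta> :: "_ \<Rightarrow> 'd" and w
    using that by (induction w) (auto simp: f(2))
  show "word_value G (\<lambda>a. \<phi> (A a)) r = \<one>\<^bsub>G\<^esub>" if "r \<in> R" "R \<subseteq> words_over S"
    using relator_value_one[OF G hom_compose[OF fh \<phi>] that(1)] that wv[of r \<phi>] by auto
  show "\<phi> = \<phi>'" if \<phi>': "\<phi>' \<in> hom \<Gamma> G" and ext: "\<phi> \<in> extensional (carrier \<Gamma>)" "\<phi>' \<in> extensional (carrier \<Gamma>)"
    and eq: "\<And>a. a \<in> S \<Longrightarrow> \<phi> (A a) = \<phi>' (A a)"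
  proof (rule extensionalityI[OF ext])
    fix x assume "x \<in> carrier \<Gamma>"
    then obtain u where u: "u \<in> words_over S" "x = f (word_class S R u)"
      using fb by (auto simp: bij_betw_def presented_group_carrier)
    have "word_value G (\<lambda>a. \<phi> (A a)) u = word_value G (\<lambda>a. \<phi>' (A a)) u"
      using u(1) by (induction u) (auto simp: eq)
    then show "\<phi> x = \<phi>' x"
      using presented_group_hom_value[OF G hom_compose[OF fh \<phi>] u(1)]
        presented_group_hom_value[OF G hom_compose[OF fh \<phi>'] u(1)] wv[OF u(1)]
      by (simp add: u(2))
  qed
qed

lemma squares_word_in_words_over: "squares_word k \<in> words_over {..<k}"
  by (auto simp: squares_word_def words_over_def)

lemma word_value_squares_word:
  assumes "\<And>i. i < k \<Longrightarrow> det (X i) = 1" "\<And>i. i < k \<Longrightarrow> g i = proj (X i)"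
  shows "word_value PSL2R g (squares_word k) = proj (squares (map X [0..<k]))"
proof -
  interpret group PSL2R by (rule group_PSL2R)
  have sq: "det (squares xs) = 1" if "\<forall>x\<in>set xs. det x = 1" for xs
    using that by (induction xs) (auto simp: det_mul)
  have "word_value PSL2R g (concat (map (\<lambda>i. [(i, True), (i, True)]) is)) = proj (squares (map X is))"
    if "set is \<subseteq> {..<k}" for "is"
    using that
  proof (induction "is")
    case Nil
    then show ?case by (simp add: PSL2R_one)
  next
    case (Cons i "is")
    then have "det (X i) = 1" "g i = proj (X i)" "\<forall>x\<in>set (map X is). det x = 1" using assms by auto
    then show ?case using Cons sq[of "map X is"]
      by (simp add: PSL2R_mult det_mul matrix_mul_assoc)
  qed
  from this[of "[0..<k]"] show ?thesis by (simp add: squares_word_def atLeast0LessThan)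
qed

section \<open>The obstruction class\<close>

definition center_element :: "bit \<Rightarrow> real^2^2" where
  "center_element n = (if n = 0 then mat 1 else - mat 1)"

lemma mat_one_neq_minus: "mat 1 \<noteq> (- mat 1 :: real^2^2)" "- mat 1 \<noteq> (mat 1 :: real^2^2)"
  by (simp_all add: mat2_eq_iff)

lemma center_element_inj: "center_element m = center_element n \<longleftrightarrow> m = n"
  using mat_one_neq_minus by (cases m; cases n) (auto simp: center_element_def)

lemma group_hom_to_SL2R: "group_hom PSL2R_cover SL2R to_SL2R"
  by (simp add: group_hom_def group_hom_axioms_def group_cover group_SL2R to_SL2R_hom)

text \<open>The kernel contains the class of the half circle of rotations, which goes to \<open>- 1\<close>. If the generator went to 1, so
  would the whole kernel.\<close>

lemma generator_of_kernel:
  assumes "generate PSL2R_cover {z} = kernel PSL2R_cover PSL2R cover_proj"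
  shows "z \<in> carrier PSL2R_cover" "to_SL2R z = - mat 1"
proof -
  interpret group_hom PSL2R_cover SL2R to_SL2R by (rule group_hom_to_SL2R)
  have "z \<in> kernel PSL2R_cover PSL2R cover_proj"
    using generate.incl[of z "{z}" PSL2R_cover] assms by simp
  then have z: "z \<in> carrier PSL2R_cover" "cover_proj z = proj (mat 1)"
    by (auto simp: kernel_def PSL2R_one)
  then show "z \<in> carrier PSL2R_cover" by simp
  have "to_SL2R z = mat 1 \<or> to_SL2R z = - mat 1"
    using proj_to_SL2R[OF z(1)] z(2) by (simp add: proj_eq_iff)
  moreover have "to_SL2R z \<noteq> mat 1"
  proof
    assume 1: "to_SL2R z = mat 1"
    let ?P = "\<lambda>t. rot (pi * t)"
    have P: "?P \<in> SL_paths" by (auto simp: SL_paths_def rot_0 intro!: continuous_intros)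
    have "cover_proj (lift_class ?P) = proj (mat 1)"
      using P by (simp add: cover_proj_lift_class rot_pi proj_eq_iff)
    then have "lift_class ?P \<in> kernel PSL2R_cover PSL2R cover_proj"
      using P by (auto simp: kernel_def cover_carrier PSL2R_one)
    then obtain k :: int where "lift_class ?P = z [^]\<^bsub>PSL2R_cover\<^esub> k"
      unfolding assms[symmetric] G.generate_pow[OF z(1)] by blast
    then have "to_SL2R (lift_class ?P) = mat 1 [^]\<^bsub>SL2R\<^esub> k"
      using hom_int_pow[OF z(1)] 1 by simp
    then have "rot pi = mat 1"
      using P H.int_pow_one[of k] by (simp add: to_SL2R_lift_class)
    then show False by (simp add: rot_pi mat_one_neq_minus)
  qed
  ultimately show "to_SL2R z = - mat 1" by simp
qed

lemma of_int_bit: "(of_int N :: bit) = (if even N then 0 else 1)"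
proof (cases "even N")
  case True
  then obtain m where "N = 2 * m" by blast
  then show ?thesis by simp
next
  case False
  then obtain m where "N = 2 * m + 1" by (rule oddE)
  then show ?thesis by simp
qed

lemma to_SL2R_power:
  assumes "z \<in> carrier PSL2R_cover" "to_SL2R z = - mat 1"
  shows "to_SL2R (z [^]\<^bsub>PSL2R_cover\<^esub> (N::int)) = center_element (of_int N)"
proof -
  interpret group_hom PSL2R_cover SL2R to_SL2R by (rule group_hom_to_SL2R)
  have m: "- mat 1 \<in> carrier SL2R" by simp
  have "(- mat 1) [^]\<^bsub>SL2R\<^esub> (2 * k) = mat 1" for k :: int
  proof -
    have "(- mat 1) [^]\<^bsub>SL2R\<^esub> (2::int) = mat 1"
      using H.int_pow_mult[OF m, of 1 1] H.int_pow_1[OF m] by simp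
    then show ?thesis
      using H.int_pow_pow[OF m, of 2 k] H.int_pow_one[of k] by simp
  qed
  then have "(- mat 1) [^]\<^bsub>SL2R\<^esub> N = center_element (of_int N)"
    using H.int_pow_mult[OF m, of _ 1] H.int_pow_1[OF m]
    by (cases "even N") (auto simp: center_element_def of_int_bit elim!: evenE oddE)
  then show ?thesis using hom_int_pow[OF assms(1)] assms(2) by simp
qed

lemma to_SL2R_squares:
  assumes "\<And>i. i \<in> set is \<Longrightarrow> a i \<in> carrier PSL2R_cover"
  shows "list_mult PSL2R_cover (map (\<lambda>i. a i [^]\<^bsub>PSL2R_cover\<^esub> (2::nat)) is) \<in> carrier PSL2R_cover"
    and "to_SL2R (list_mult PSL2R_cover (map (\<lambda>i. a i [^]\<^bsub>PSL2R_cover\<^esub> (2::nat)) is)) = squares (map (\<lambda>i. to_SL2R (a i)) is)"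
proof -
  interpret group_hom PSL2R_cover SL2R to_SL2R by (rule group_hom_to_SL2R)
  have "list_mult PSL2R_cover (map (\<lambda>i. a i [^]\<^bsub>PSL2R_cover\<^esub> (2::nat)) is) \<in> carrier PSL2R_cover
    \<and> to_SL2R (list_mult PSL2R_cover (map (\<lambda>i. a i [^]\<^bsub>PSL2R_cover\<^esub> (2::nat)) is)) = squares (map (\<lambda>i. to_SL2R (a i)) is)"
    using assms
  proof (induction "is")
    case Nil
    then show ?case using hom_one by (simp add: list_mult_def)
  next
    case (Cons i "is")
    have a: "a i \<in> carrier PSL2R_cover" using Cons.prems by simp
    have "a i [^]\<^bsub>PSL2R_cover\<^esub> (2::nat) = a i \<otimes>\<^bsub>PSL2R_cover\<^esub> a i"
      using a by (simp add: numeral_2_eq_2)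
    then show ?case using Cons a by (simp add: list_mult_def matrix_mul_assoc)
  qed
  then show "list_mult PSL2R_cover (map (\<lambda>i. a i [^]\<^bsub>PSL2R_cover\<^esub> (2::nat)) is) \<in> carrier PSL2R_cover"
    "to_SL2R (list_mult PSL2R_cover (map (\<lambda>i. a i [^]\<^bsub>PSL2R_cover\<^esub> (2::nat)) is)) = squares (map (\<lambda>i. to_SL2R (a i)) is)"
    by auto
qed

text \<open>Up to sign the trace is greater than \<open>- 2\<close>, and then the normalized segment from the identity is a path in \<open>SL(2,\<real>)\<close>.\<close>

lemma cover_proj_surj:
  assumes "det X = 1"
  obtains C where "C \<in> carrier PSL2R_cover" "cover_proj C = proj X"
proof -
  note result = that
  have pos: thesis if Y: "det Y = 1" "trace Y > -2" "proj Y = proj X" for Y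
  proof -
    define D where "D s = (1 - s)\<^sup>2 + s\<^sup>2 + s * (1 - s) * trace Y" for s
    define P where "P s = (1 / sqrt (D s)) *\<^sub>R ((1 - s) *\<^sub>R mat 1 + s *\<^sub>R Y)" for s
    have D: "D s > 0" if "s \<in> {0..1}" for s
      using shrink_bound(1)[OF Y(2) Y(2) _, of 2 s] that by (simp add: D_def)
    have "det ((1 - s) *\<^sub>R mat 1 + s *\<^sub>R Y) = D s" for s
      using det_pencil[OF Y(1) Y(1), of 1 "1 - s"] by (simp add: D_def algebra_simps)
    then have "det (P s) = 1" if "s \<in> {0..1}" for s
      using D[OF that] by (simp add: P_def power_divide)
    moreover have "continuous_on {0..1} P"
    proof -
      have "continuous_on {0..1} D" unfolding D_def by (intro continuous_intros)
      moreover have "sqrt (D s) \<noteq> 0" if "s \<in> {0..1}" for s using D[OF that] by simp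
      ultimately show ?thesis unfolding P_def by (auto intro!: continuous_intros)
    qed
    moreover have "P 0 = mat 1" "P 1 = Y" by (simp_all add: P_def D_def)
    ultimately have "P \<in> SL_paths" by (simp add: SL_paths_def)
    then show ?thesis
      using result[of "lift_class P"] \<open>P 1 = Y\<close> Y(3) by (auto simp: cover_carrier cover_proj_lift_class)
  qed
  show ?thesis
  proof (cases "trace X > -2")
    case True
    then show ?thesis using pos[of X] assms by simp
  next
    case False
    then show ?thesis using pos[of "- X"] assms by (simp add: proj_eq_iff)
  qed
qed

text \<open>Lifts to the universal cover go under \<open>to_SL2R\<close> to lifts to \<open>SL(2,\<real>)\<close>, and the power \<open>z\<^sup>N\<close> goes to \<open>(- 1)\<^sup>N\<close>; so the parity
  of \<open>N\<close> is the exponent of the sign of the product of squares.\<close>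

lemma obstruction_class_eq:
  assumes gen: "generate PSL2R_cover {z} = kernel PSL2R_cover PSL2R cover_proj"
    and X: "\<And>i. i < k \<Longrightarrow> det (X i) = 1" "\<And>i. i < k \<Longrightarrow> \<phi> (A i) = proj (X i)"
    and n: "squares (map X [0..<k]) = center_element n"
  shows "obstruction_class z k A \<phi> = n"
proof -
  interpret group_hom PSL2R_cover SL2R to_SL2R by (rule group_hom_to_SL2R)
  note z = generator_of_kernel[OF gen]
  let ?L = "\<lambda>a. list_mult PSL2R_cover (map (\<lambda>i. a i [^]\<^bsub>PSL2R_cover\<^esub> (2::nat)) [0..<k])"
  have L: "?L a \<in> carrier PSL2R_cover" "to_SL2R (?L a) = center_element n"
    if a: "\<forall>i<k. a i \<in> carrier PSL2R_cover \<and> cover_proj (a i) = \<phi> (A i)" for a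
  proof -
    show "?L a \<in> carrier PSL2R_cover" using to_SL2R_squares(1)[of "[0..<k]" a] a by simp
    have "to_SL2R (a i) = X i \<or> to_SL2R (a i) = - X i" if "i < k" for i
      using proj_to_SL2R[of "a i"] a that X(2)[OF that] by (auto simp: proj_eq_iff)
    then have "list_all2 (\<lambda>x y. det x = 1 \<and> (y = x \<or> y = - x)) (map X [0..<k]) (map (\<lambda>i. to_SL2R (a i)) [0..<k])"
      using X(1) by (auto simp: list_all2_map1 list_all2_map2 list_all2_same)
    from squares_sign[OF this] n
    have "squares (map (\<lambda>i. to_SL2R (a i)) [0..<k]) = center_element n" by simp
    then show "to_SL2R (?L a) = center_element n"
      using to_SL2R_squares(2)[of "[0..<k]" a] a by simp
  qed
  have "\<exists>C. C \<in> carrier PSL2R_cover \<and> cover_proj C = \<phi> (A i)" if "i < k" for i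
    using cover_proj_surj[OF X(1)[OF that]] X(2)[OF that] by metis
  then obtain a where a: "\<forall>i<k. a i \<in> carrier PSL2R_cover \<and> cover_proj (a i) = \<phi> (A i)" by metis
  have "cover_proj (?L a) = proj (center_element n)"
    unfolding L(2)[OF a, symmetric] by (rule proj_to_SL2R[OF L(1)[OF a], symmetric])
  also have "\<dots> = \<one>\<^bsub>PSL2R\<^esub>" by (simp add: center_element_def proj_eq_iff PSL2R_one)
  finally have "?L a \<in> generate PSL2R_cover {z}"
    unfolding gen kernel_def using L(1)[OF a] by blast
  then obtain N :: int where N: "?L a = z [^]\<^bsub>PSL2R_cover\<^esub> N"
    unfolding G.generate_pow[OF z(1)] by blast
  have un: "m = n" if "\<forall>i<k. b i \<in> carrier PSL2R_cover \<and> cover_proj (b i) = \<phi> (A i)"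
    "?L b = z [^]\<^bsub>PSL2R_cover\<^esub> M" "m = of_int M" for b and M :: int and m
    using L(2)[OF that(1)] to_SL2R_power[OF z, of M] that(2,3) by (simp add: center_element_inj)
  show ?thesis
    unfolding obstruction_class_def
  proof (rule the_equality)
    show "\<exists>a N. (\<forall>i<k. a i \<in> carrier PSL2R_cover \<and> cover_proj (a i) = \<phi> (A i)) \<and>
        ?L a = z [^]\<^bsub>PSL2R_cover\<^esub> N \<and> n = of_int N"
      using a N un[OF a N refl] by blast
  qed (use un in blast)
qed

section \<open>The representation space\<close>

locale nonorientable_surface_group =
  fixes \<Gamma> :: "('g, 'm) monoid_scheme" and k :: nat and A :: "nat \<Rightarrow> 'g"
  assumes presentation: "has_presentation \<Gamma> {..<k} {squares_word k} A"
begin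

definition rep_space :: "('g \<Rightarrow> (real^2^2) set) topology" where
  "rep_space = Hom_space \<Gamma> k A PSL2R PSL2R_topology"

lemma topspace_rep_space: "topspace rep_space = hom \<Gamma> PSL2R \<inter> extensional (carrier \<Gamma>)"
proof -
  have "\<phi> (A i) \<in> topspace PSL2R_topology" if "\<phi> \<in> hom \<Gamma> PSL2R" "i < k" for \<phi> i
    using hom_in_carrier[OF that(1) presentation_hom_carrier[OF presentation group_PSL2R that(1)]] that(2)
    by (simp add: topspace_PSL2R PSL2R_carrier)
  then show ?thesis
    by (auto simp: rep_space_def Hom_space_def topspace_pullback_topology)
qed

lemma lifts_exist:
  assumes "\<phi> \<in> topspace rep_space"
  obtains xs n where "length xs = k" "\<forall>x\<in>set xs. det x = 1" "\<forall>i<k. \<phi> (A i) = proj (xs ! i)"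
    "squares xs = center_element n"
proof -
  have \<phi>: "\<phi> \<in> hom \<Gamma> PSL2R" using assms by (simp add: topspace_rep_space)
  have "\<exists>X. det X = 1 \<and> \<phi> (A i) = proj X" if "i < k" for i
    using hom_in_carrier[OF \<phi> presentation_hom_carrier[OF presentation group_PSL2R \<phi>]] that
    by (auto simp: PSL2R_carrier)
  then obtain X where X: "\<And>i. i < k \<Longrightarrow> det (X i) = 1 \<and> \<phi> (A i) = proj (X i)" by metis
  have "proj (squares (map X [0..<k])) = word_value PSL2R (\<lambda>i. \<phi> (A i)) (squares_word k)"
    using X by (intro word_value_squares_word[symmetric]) auto
  also have "\<dots> = proj (mat 1)"
    using presentation_relator[OF presentation group_PSL2R \<phi>, of "squares_word k"] squares_word_in_words_over
    by (simp add: PSL2R_one)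
  finally have "squares (map X [0..<k]) = center_element 0 \<or> squares (map X [0..<k]) = center_element 1"
    by (simp add: proj_eq_iff center_element_def)
  then obtain n where "squares (map X [0..<k]) = center_element n" by blast
  then show ?thesis using X by (intro that[of "map X [0..<k]" n]) auto
qed

text \<open>Well defined when the product of the squares of the matrices is central: the representation then exists, and it is determined by its values on the generators.\<close>

definition rep_of :: "(real^2^2) list \<Rightarrow> 'g \<Rightarrow> (real^2^2) set" where
  "rep_of xs = (SOME \<phi>. \<phi> \<in> topspace rep_space \<and> (\<forall>i<k. \<phi> (A i) = proj (xs ! i)))"

definition admissible :: "bit \<Rightarrow> (real^2^2) list \<Rightarrow> bool" where
  "admissible n xs \<longleftrightarrow> length xs = k \<and> (\<forall>x\<in>set xs. det x = 1) \<and> squares xs = center_element n"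

lemma rep_of:
  assumes "admissible n xs"
  shows "rep_of xs \<in> topspace rep_space" "\<And>i. i < k \<Longrightarrow> rep_of xs (A i) = proj (xs ! i)"
proof -
  have xs: "length xs = k" "\<And>i. i < k \<Longrightarrow> det (xs ! i) = 1" "squares xs = center_element n"
    using assms by (auto simp: admissible_def)
  have "word_value PSL2R (\<lambda>i. proj (xs ! i)) (squares_word k) = proj (squares (map (\<lambda>i. xs ! i) [0..<k]))"
    using xs by (intro word_value_squares_word) auto
  also have "\<dots> = \<one>\<^bsub>PSL2R\<^esub>"
    using xs map_nth[of xs] by (simp add: PSL2R_one center_element_def proj_eq_iff)
  finally have v: "word_value PSL2R (\<lambda>i. proj (xs ! i)) (squares_word k) = \<one>\<^bsub>PSL2R\<^esub>" .
  obtain \<phi> where "\<phi> \<in> hom \<Gamma> PSL2R \<inter> extensional (carrier \<Gamma>)" "\<And>i. i \<in> {..<k} \<Longrightarrow> \<phi> (A i) = proj (xs ! i)"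
  proof (rule presentation_hom_exists[OF presentation group_PSL2R, of "\<lambda>i. proj (xs ! i)"])
    show "proj (xs ! i) \<in> carrier PSL2R" if "i \<in> {..<k}" for i
      using xs that by (auto simp: PSL2R_carrier)
  qed (use v squares_word_in_words_over in auto)
  then have "\<exists>\<phi>. \<phi> \<in> topspace rep_space \<and> (\<forall>i<k. \<phi> (A i) = proj (xs ! i))"
    by (auto simp: topspace_rep_space)
  from someI_ex[OF this] show "rep_of xs \<in> topspace rep_space" "\<And>i. i < k \<Longrightarrow> rep_of xs (A i) = proj (xs ! i)"
    by (auto simp: rep_of_def)
qed

lemma rep_of_unique:
  assumes "admissible n xs" "\<phi> \<in> topspace rep_space" "\<And>i. i < k \<Longrightarrow> \<phi> (A i) = proj (xs ! i)"
  shows "rep_of xs = \<phi>"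
  using rep_of[OF assms(1)] assms(2,3)
  by (intro presentation_hom_unique[OF presentation group_PSL2R]) (auto simp: topspace_rep_space)

lemma admissible_deform:
  assumes "deform xs ys" "admissible n xs" shows "admissible n ys"
  using assms deform_length deform_det deform_squares by (auto simp: admissible_def)

text \<open>A path of tuples is a path of representations since the topology of the representation space is read off from the generators; a change of signs leaves the representation fixed.\<close>

lemma connected_component_of_deform:
  assumes "deform xs ys" "admissible n xs"
  shows "connected_component_of rep_space (rep_of xs) (rep_of ys)"
  using assms
proof (induction rule: deform.induct)
  case (path gs W)
  let ?x = "\<lambda>s. map (\<lambda>g. g s) gs"
  have ad: "admissible n (?x s)" if "s \<in> {0..1}" for s
    using path that by (force simp: admissible_def)
  have "continuous_map (top_of_set {0..1}) rep_space (\<lambda>s. rep_of (?x s))"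
    unfolding rep_space_def Hom_space_def
  proof (rule continuous_map_pullback')
    show "topspace (top_of_set {0..1}) \<subseteq> (\<lambda>s. rep_of (?x s)) -` (hom \<Gamma> PSL2R \<inter> extensional (carrier \<Gamma>))"
      using rep_of(1)[OF ad] by (auto simp: topspace_rep_space)
    show "continuous_map (top_of_set {0..1}) (product_topology (\<lambda>_. PSL2R_topology) {..<k})
       ((\<lambda>\<phi>. \<lambda>i\<in>{..<k}. \<phi> (A i)) \<circ> (\<lambda>s. rep_of (?x s)))"
      unfolding continuous_map_componentwise
    proof (intro conjI ballI)
      fix i assume "i \<in> {..<k}"
      then have i: "i < k" by simp
      have len: "length gs = k" using ad[of 0] by (simp add: admissible_def)
      have "continuous_map (top_of_set {0..1}) PSL2R_topology (\<lambda>s. proj ((gs ! i) s))"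
        using path i len by (intro continuous_map_proj) auto
      then show "continuous_map (top_of_set {0..1}) PSL2R_topology
          (\<lambda>s. ((\<lambda>\<phi>. \<lambda>i\<in>{..<k}. \<phi> (A i)) \<circ> (\<lambda>s. rep_of (?x s))) s i)"
        by (rule continuous_map_eq) (use i len rep_of(2)[OF ad] in auto)
    qed auto
  qed
  moreover have "connectedin (top_of_set {0..1}) {0..1::real}"
    by (simp add: connectedin_subtopology)
  ultimately have "connectedin rep_space ((\<lambda>s. rep_of (?x s)) ` {0..1})"
    by (rule connectedin_continuous_map_image)
  then show ?case
    unfolding connected_component_of_def by (intro exI conjI) auto
next
  case (sign xs ys)
  have ad: "admissible n ys" using admissible_deform[OF deform.sign[OF sign(1)] sign(2)] .
  have "rep_of ys (A i) = proj (xs ! i)" if "i < k" for i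
    using rep_of(2)[OF ad that] list_all2_nthD2[OF sign(1), of i] ad that
    by (auto simp: admissible_def proj_eq_iff)
  then have "rep_of xs = rep_of ys"
    using rep_of_unique[OF sign(2) rep_of(1)[OF ad]] by simp
  then show ?case using rep_of(1)[OF ad] by (simp add: connected_component_of_refl)
next
  case (trans xs ys zs)
  have "admissible n ys" using admissible_deform[OF trans(1) trans.prems] .
  with trans show ?case by (blast intro: connected_component_of_trans)
qed

lemma ex_root_of_center: "\<exists>h. det h = 1 \<and> h ** h = center_element n"
proof (cases "n = 0")
  case True
  then show ?thesis by (intro exI[of _ "mat 1"]) (simp add: center_element_def)
next
  case False
  then show ?thesis by (intro exI[of _ "rot (pi/2)"]) (simp add: center_element_def rot_half_pi)
qed

lemma connected_component_of_admissible:
  assumes k: "k \<ge> 2" and "admissible n xs" "admissible n ys"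
  shows "connected_component_of rep_space (rep_of xs) (rep_of ys)"
proof -
  obtain h where h: "det h = 1" "h ** h = center_element n" using ex_root_of_center by blast
  have std: "connected_component_of rep_space (rep_of us) (rep_of (h # replicate (k - 1) (mat 1)))" if "admissible n us" for us
    using deform_to_standard[of us h] that k h
    by (intro connected_component_of_deform[OF _ that]) (auto simp: admissible_def)
  have "connected_component_of rep_space (rep_of (h # replicate (k - 1) (mat 1))) (rep_of ys)"
    unfolding connected_component_of_sym[of rep_space _ "rep_of ys"] by (rule std[OF assms(3)])
  with std[OF assms(2)] show ?thesis by (rule connected_component_of_trans)
qed

text \<open>Squaring is invariant under the change of sign, so it descends to a continuous map from \<open>PSL(2,\<real>)\<close> to matrices.\<close>

definition square_lift :: "(real^2^2) set \<Rightarrow> real^2^2" where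
  "square_lift C = (SOME X. X \<in> C) ** (SOME X. X \<in> C)"

lemma square_lift_proj: "square_lift (proj X) = X ** X"
proof -
  have "(SOME Y. Y \<in> proj X) \<in> proj X"
    by (rule someI[of _ X]) (simp add: proj_eq)
  then show ?thesis by (auto simp: square_lift_def proj_eq)
qed

lemma continuous_map_squares:
  "continuous_map rep_space euclidean (\<lambda>\<phi>. foldr (\<lambda>i p. square_lift (\<phi> (A i)) ** p) is (mat 1))"
  if "set is \<subseteq> {..<k}"
  using that
proof (induction "is")
  case (Cons i "is")
  have "continuous_map (product_topology (\<lambda>_. PSL2R_topology) {..<k}) PSL2R_topology (\<lambda>f. f i)"
    using Cons.prems by (intro continuous_map_product_projection) auto
  then have "continuous_map rep_space PSL2R_topology ((\<lambda>f. f i) \<circ> (\<lambda>\<phi>. \<lambda>i\<in>{..<k}. \<phi> (A i)))"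
    unfolding rep_space_def Hom_space_def by (rule continuous_map_pullback)
  then have "continuous_map rep_space PSL2R_topology (\<lambda>\<phi>. \<phi> (A i))"
    using Cons.prems by (simp add: o_def)
  moreover have "continuous_map PSL2R_topology euclidean square_lift"
    by (rule continuous_map_descend[where g = "\<lambda>X. X ** X"])
       (auto simp: square_lift_proj intro!: continuous_intros)
  ultimately have "continuous_map rep_space euclidean (square_lift \<circ> (\<lambda>\<phi>. \<phi> (A i)))"
    by (rule continuous_map_compose)
  then have "continuous_map rep_space euclidean (\<lambda>\<phi>. square_lift (\<phi> (A i)))"
    by (simp add: o_def)
  moreover have "continuous_map rep_space euclidean (\<lambda>\<phi>. foldr (\<lambda>i p. square_lift (\<phi> (A i)) ** p) is (mat 1))"
    using Cons by auto
  ultimately have "continuous_map rep_space (prod_topology euclidean euclidean)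
     (\<lambda>\<phi>. (square_lift (\<phi> (A i)), foldr (\<lambda>i p. square_lift (\<phi> (A i)) ** p) is (mat 1)))"
    by (simp only: continuous_map_paired)
  moreover have "continuous_map (prod_topology euclidean euclidean) euclidean (\<lambda>p::(real^2^2) \<times> (real^2^2). fst p ** snd p)"
    unfolding prod_topology_euclidean by (simp add: continuous_intros)
  ultimately have "continuous_map rep_space euclidean ((\<lambda>p. fst p ** snd p) \<circ>
     (\<lambda>\<phi>. (square_lift (\<phi> (A i)), foldr (\<lambda>i p. square_lift (\<phi> (A i)) ** p) is (mat 1))))"
    by (rule continuous_map_compose)
  then show ?case by (simp add: o_def)
qed simp

text \<open>The product of the squares is a continuous function of the representation with finitely many values.\<close>

lemma sign_constant_on_connected_component:
  assumes c: "connected_component_of rep_space (rep_of xs) (rep_of ys)" and "admissible m xs" "admissible n ys"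
  shows "m = n"
proof -
  let ?q = "\<lambda>\<phi>. foldr (\<lambda>i p. square_lift (\<phi> (A i)) ** p) [0..<k] (mat 1)"
  have q: "?q (rep_of us) = center_element l" if us: "admissible l us" for us l
  proof -
    have "foldr (\<lambda>i p. square_lift (rep_of us (A i)) ** p) is (mat 1) = squares (map (\<lambda>i. us ! i) is)"
      if "set is \<subseteq> {..<k}" for "is"
      using that by (induction "is") (auto simp: rep_of(2)[OF us] square_lift_proj)
    from this[of "[0..<k]"] show ?thesis
      using us map_nth[of us] by (auto simp: admissible_def atLeast0LessThan)
  qed
  obtain T where T: "connectedin rep_space T" "rep_of xs \<in> T" "rep_of ys \<in> T"
    using c by (auto simp: connected_component_of_def)
  have con: "connected (?q ` T)"
    using connectedin_continuous_map_image[OF continuous_map_squares T(1), of "[0..<k]"]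
    by (simp add: atLeast0LessThan)
  have sub: "?q ` T \<subseteq> range center_element"
  proof
    fix y assume "y \<in> ?q ` T"
    then obtain \<phi> where \<phi>: "\<phi> \<in> T" "y = ?q \<phi>" by blast
    then have top: "\<phi> \<in> topspace rep_space" using connectedin_subset_topspace[OF T(1)] by blast
    then obtain us l where "length us = k" "\<forall>x\<in>set us. det x = 1" "\<forall>i<k. \<phi> (A i) = proj (us ! i)"
      "squares us = center_element l" by (rule lifts_exist)
    then have "admissible l us" "rep_of us = \<phi>"
      using rep_of_unique[of l us \<phi>] top by (auto simp: admissible_def)
    then show "y \<in> range center_element" using q \<phi> by auto
  qed
  have "finite (range center_element)"
    by (rule finite_subset[of _ "{mat 1, - mat 1}"]) (auto simp: center_element_def)
  then have "finite (?q ` T)" using sub finite_subset by blast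
  then obtain c where "?q ` T = {c}"
    using con T(2) connected_finite_iff_sing by blast
  then have "?q (rep_of xs) = c" "?q (rep_of ys) = c"
    using imageI[OF T(2), of ?q] imageI[OF T(3), of ?q] by simp_all
  then have "?q (rep_of xs) = ?q (rep_of ys)" by simp
  then show ?thesis using q assms by (simp add: center_element_inj)
qed

theorem components_of_rep_space:
  assumes k: "k \<ge> 2" and z: "generate PSL2R_cover {z} = kernel PSL2R_cover PSL2R cover_proj"
  shows "bij_betw (obstruction_class_pi0 z k A) (connected_components_of rep_space) UNIV"
    and "card (connected_components_of rep_space) = 2"
    and "connected_components_of rep_space = range (\<lambda>n. {\<phi> \<in> topspace rep_space. obstruction_class z k A \<phi> = n})"
proof -
  let ?F = "\<lambda>n. {\<phi> \<in> topspace rep_space. obstruction_class z k A \<phi> = n}"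
  have ob: "obstruction_class z k A (rep_of xs) = n" if "admissible n xs" for n xs
  proof (rule obstruction_class_eq[OF z])
    show "squares (map (\<lambda>i. xs ! i) [0..<k]) = center_element n"
      using that map_nth[of xs] by (auto simp: admissible_def)
  qed (use that rep_of(2)[OF that] in \<open>auto simp: admissible_def\<close>)
  have adm: "\<exists>xs. admissible (obstruction_class z k A \<phi>) xs \<and> rep_of xs = \<phi>" if top: "\<phi> \<in> topspace rep_space" for \<phi>
  proof -
    obtain xs l where "length xs = k" "\<forall>x\<in>set xs. det x = 1" "\<forall>i<k. \<phi> (A i) = proj (xs ! i)"
      "squares xs = center_element l" using top by (rule lifts_exist)
    then have "admissible l xs" "rep_of xs = \<phi>"
      using rep_of_unique[of l xs \<phi>] top by (auto simp: admissible_def)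
    then show ?thesis using ob by blast
  qed
  have comp: "connected_component_of_set rep_space \<phi> = ?F (obstruction_class z k A \<phi>)" if top: "\<phi> \<in> topspace rep_space" for \<phi>
  proof (intro equalityI subsetI)
    fix \<psi> assume "\<psi> \<in> connected_component_of_set rep_space \<phi>"
    then have c: "connected_component_of rep_space \<phi> \<psi>" by simp
    then have top': "\<psi> \<in> topspace rep_space" by (simp add: connected_component_of_equiv)
    obtain xs ys where *: "admissible (obstruction_class z k A \<phi>) xs" "rep_of xs = \<phi>"
      "admissible (obstruction_class z k A \<psi>) ys" "rep_of ys = \<psi>"
      using adm[OF top] adm[OF top'] by blast
    then have "obstruction_class z k A \<phi> = obstruction_class z k A \<psi>"
      using sign_constant_on_connected_component[OF _ *(1,3)] c by simp
    then show "\<psi> \<in> ?F (obstruction_class z k A \<phi>)" using top' by simp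
  next
    fix \<psi> assume \<psi>: "\<psi> \<in> ?F (obstruction_class z k A \<phi>)"
    obtain xs ys where "admissible (obstruction_class z k A \<phi>) xs" "rep_of xs = \<phi>"
      "admissible (obstruction_class z k A \<phi>) ys" "rep_of ys = \<psi>"
      using adm[OF top] adm[of \<psi>] \<psi> by auto
    then show "\<psi> \<in> connected_component_of_set rep_space \<phi>"
      using connected_component_of_admissible[OF k] by auto
  qed
  have nonempty: "\<exists>\<phi>\<in>topspace rep_space. obstruction_class z k A \<phi> = n" for n
  proof -
    obtain h where h: "det h = 1" "h ** h = center_element n" using ex_root_of_center by blast
    have "squares (replicate l (mat 1)) = mat 1" for l by (induction l) auto
    then have "admissible n (h # replicate (k - 1) (mat 1))"
      using h k by (auto simp: admissible_def)
    then show ?thesis using ob rep_of(1) by blast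
  qed
  show comps: "connected_components_of rep_space = range ?F"
  proof (intro equalityI subsetI)
    fix C assume "C \<in> connected_components_of rep_space"
    then show "C \<in> range ?F" unfolding connected_components_of_def using comp by auto
  next
    fix C assume "C \<in> range ?F"
    then obtain n where C: "C = ?F n" by blast
    obtain \<phi> where \<phi>: "\<phi> \<in> topspace rep_space" "obstruction_class z k A \<phi> = n" using nonempty by blast
    then have "C = connected_component_of_set rep_space \<phi>" using comp C by simp
    then show "C \<in> connected_components_of rep_space"
      using \<phi> by (simp add: connected_component_in_connected_components_of)
  qed
  have pi0: "obstruction_class_pi0 z k A (?F n) = n" for n
    unfolding obstruction_class_pi0_def
  proof (rule the_equality)
    fix m assume m: "\<forall>\<phi>\<in>?F n. obstruction_class z k A \<phi> = m"
    obtain \<phi> where \<phi>: "\<phi> \<in> topspace rep_space" "obstruction_class z k A \<phi> = n" using nonempty by blast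
    then have "obstruction_class z k A \<phi> = m" using m by blast
    then show "m = n" using \<phi>(2) by simp
  qed simp
  show bij: "bij_betw (obstruction_class_pi0 z k A) (connected_components_of rep_space) UNIV"
    unfolding comps
    by (rule bij_betw_byWitness[where f' = ?F]) (simp_all add: pi0)
  have "(UNIV :: bit set) = {0, 1}" by auto
  then have "card (UNIV :: bit set) = 2"
    unfolding card_2_iff by (intro exI[of _ 0] exI[of _ 1] conjI) simp_all
  then show "card (connected_components_of rep_space) = 2"
    using bij_betw_same_card[OF bij] by simp
qed

end

theorem theorem1p1:
  fixes M :: "'a topology" and k :: nat and x :: 'a
    and A :: "nat \<Rightarrow> (real \<Rightarrow> 'a) set"
    and z :: "(real \<Rightarrow> (real^2^2) set) set"
  assumes "closed_nonorientable_surface k M" and "k \<ge> 3"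
    and "x \<in> topspace M"
    and "has_presentation (fundamental_group M x) {..<k} {squares_word k} A"
    and "generate PSL2R_cover {z} = kernel PSL2R_cover PSL2R cover_proj"
  shows "let H = Hom_space (fundamental_group M x) k A PSL2R PSL2R_topology in
     bij_betw (obstruction_class_pi0 z k A) (connected_components_of H) UNIV \<and>
     card (connected_components_of H) = 2 \<and>
     connected_components_of H =
       range (\<lambda>n. {\<phi> \<in> topspace H. obstruction_class z k A \<phi> = n})"
proof -
  interpret nonorientable_surface_group "fundamental_group M x" k A
    by unfold_locales (rule assms(4))
  show ?thesis
    using components_of_rep_space[OF _ assms(5)] assms(2) by (simp add: Let_def rep_space_def)
qed

end
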